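(* Let $\Sigma\le S_n$ be a Young subgroup and $G\le\Sigma$ a subgroup of index $\ell=[\Sigma:G]$. For every set of universal secondaries $\theta_*=(\theta_1,\dots,\theta_\ell)$, $\theta_i\in\mathbb{Z}[V]^G$, and every prime $p$, the ring $\mathbb{F}_p[V]^G$ is Cohen-Macaulay if and only if $p$ does not divide $\mho(\theta_* )$, the content of $\det M(\theta_* )$.
   Context: $\Sigma=S_{k_1}\times\cdots\times S_{k_r}$ with $k_1+\dots+k_r=n$. For a commutative ring $R$, $R[V]=R[x_1,\dots,x_n]$, on which $S_n$ acts by permuting the variables; $R[V]^H$ is the subring of $H$-invariants. $R[V]^\Sigma$ is a polynomial ring over $R$, and $R[V]^G$ is called Cohen-Macaulay if it is free as an $R[V]^\Sigma$-module. A set of secondary invariants (secondaries) for $\mathbb{Q}[V]^G$ is a minimal set of homogeneous generators of $\mathbb{Q}[V]^G$ as a $\mathbb{Q}[V]^\Sigma$-module; it has exactly $\ell$ elements and is a module basis. A set of universal secondaries is a set of secondaries $\theta_1,\dots,\theta_\ell$ for $\mathbb{Q}[V]^G$ lying in $\mathbb{Z}[V]^G$ such that $\mathbb{F}_p[V]^G=\bigoplus_{i=1}^\ell\mathbb{F}_p[V]^\Sigma\,\overline{\theta}_i$ for every prime $p$ for which $\mathbb{F}_p[V]^G$ is Cohen-Macaulay, where $\overline\theta_i$ is the reduction of $\theta_i$ mod $p$. Let $\gamma_1,\dots,\gamma_\ell$ be left coset representatives of $G$ in $\Sigma$; $M(\theta_* )=[\gamma_i\theta_j]_{1\le i,j\le\ell}$.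 The content of a polynomial in $\mathbb{Z}[V]$ is the gcd of its coefficients. *)

theory Defs
  imports
    "HOL-Library.Poly_Mapping"
    "HOL-Algebra.Left_Coset"
    "HOL-Algebra.Sym_Groups"
    "HOL-Number_Theory.Residues"
    "Jordan_Normal_Form.VS_Connect"
    "Jordan_Normal_Form.Determinant"
begin

section \<open>Polynomial rings \<open>R[V] = R[x\<^sub>1, \<dots>, x\<^sub>n]\<close>\<close>

text \<open>
  A monomial \<open>x\<^sub>1^m\<^sub>1 \<cdots> x\<^sub>n^m\<^sub>n\<close> is the exponent function \<open>m\<close>, and a polynomial is a finitely
  supported family of coefficients.
\<close>

type_synonym 'r mpoly = "(nat \<Rightarrow>\<^sub>0 nat) \<Rightarrow>\<^sub>0 'r"

text \<open>
  The coefficient ring is a ring structure, so that \<open>\<int>\<close>, \<open>\<rat>\<close> (as \<^const>\<open>class_ring\<close>) and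
  \<open>\<bbbF>\<^sub>p\<close> (as \<^term>\<open>residue_ring (int p)\<close>, with \<open>p\<close> a variable) are treated uniformly. The zero of
  the structure has to be the \<open>0\<close> of the underlying type, as is the case for these three.
\<close>

definition mpoly_ring :: "('r::zero, 'e) ring_scheme \<Rightarrow> nat \<Rightarrow> 'r mpoly ring" where
  "mpoly_ring R n =
    \<lparr>carrier = {f. (\<forall>m. Poly_Mapping.lookup f m \<in> carrier R) \<and> (\<forall>m \<in> Poly_Mapping.keys f. Poly_Mapping.keys m \<subseteq> {1..n})},
     monoid.mult = \<lambda>f g. Abs_poly_mapping (\<lambda>m.
       \<Oplus>\<^bsub>R\<^esub>ab \<in> {ab. fst ab + snd ab = m}. Poly_Mapping.lookup f (fst ab) \<otimes>\<^bsub>R\<^esub> Poly_Mapping.lookup g (snd ab)),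
     one = Poly_Mapping.single 0 \<one>\<^bsub>R\<^esub>,
     zero = 0,
     add = \<lambda>f g. Abs_poly_mapping (\<lambda>m. Poly_Mapping.lookup f m \<oplus>\<^bsub>R\<^esub> Poly_Mapping.lookup g m)\<rparr>"

definition total_degree :: "(nat \<Rightarrow>\<^sub>0 nat) \<Rightarrow> nat" where
  "total_degree m = (\<Sum>i \<in> Poly_Mapping.keys m. Poly_Mapping.lookup m i)"

definition homogeneous :: "'r::zero mpoly \<Rightarrow> bool" where
  "homogeneous f \<longleftrightarrow> (\<exists>d. \<forall>m \<in> Poly_Mapping.keys f. total_degree m = d)"

definition mpoly_content :: "int mpoly \<Rightarrow> int" where
  "mpoly_content f = Gcd (range (Poly_Mapping.lookup f))"

definition to_rat_mpoly :: "int mpoly \<Rightarrow> rat mpoly" where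
  "to_rat_mpoly = Poly_Mapping.map of_int"

definition reduce_mod :: "nat \<Rightarrow> int mpoly \<Rightarrow> int mpoly" where
  "reduce_mod p = Poly_Mapping.map (\<lambda>c. c mod int p)"


section \<open>Permutation action, Young subgroups, invariants\<close>

text \<open>
  The left action with \<open>\<sigma> x\<^sub>i = x\<^bsub>\<sigma> i\<^esub>\<close>: the coefficient of \<open>\<sigma> f\<close> at \<open>m\<close> is that of \<open>f\<close> at
  \<open>m \<circ> \<sigma>\<close> (see \<open>perm_act_monomial\<close> below).
\<close>

definition perm_act :: "(nat \<Rightarrow> nat) \<Rightarrow> 'r::zero mpoly \<Rightarrow> 'r mpoly" where
  "perm_act \<sigma> f = Poly_Mapping.map_key (Poly_Mapping.map_key \<sigma>) f"

text \<open>
  For \<open>k = [k\<^sub>1, \<dots>, k\<^sub>r]\<close>, the subgroup \<open>S\<^bsub>k\<^sub>1\<^esub> \<times> \<cdots> \<times> S\<^bsub>k\<^sub>r\<^esub>\<close> of the symmetric group on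
  \<open>{1..n}\<close>, where \<open>n = k\<^sub>1 + \<cdots> + k\<^sub>r\<close>: the factors permute consecutive blocks of lengths
  \<open>k\<^sub>1, \<dots>, k\<^sub>r\<close>.
\<close>

definition young_block :: "nat list \<Rightarrow> nat \<Rightarrow> nat set" where
  "young_block k i = {sum_list (take i k) <.. sum_list (take (Suc i) k)}"

definition young_subgroup :: "nat list \<Rightarrow> (nat \<Rightarrow> nat) set" where
  "young_subgroup k = {\<sigma> \<in> carrier (sym_group (sum_list k)).
     \<forall>i < length k. \<sigma> ` young_block k i = young_block k i}"

definition young_group :: "nat list \<Rightarrow> (nat \<Rightarrow> nat) monoid" where
  "young_group k = (sym_group (sum_list k))\<lparr>carrier := young_subgroup k\<rparr>"

definition young_index :: "nat list \<Rightarrow> (nat \<Rightarrow> nat) set \<Rightarrow> nat" where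
  "young_index k G = card (lcosets\<^bsub>young_group k\<^esub> G)"

definition left_coset_reps :: "nat list \<Rightarrow> (nat \<Rightarrow> nat) set \<Rightarrow> (nat \<Rightarrow> nat \<Rightarrow> nat) \<Rightarrow> bool" where
  "left_coset_reps k G \<gamma> \<longleftrightarrow>
     (\<forall>i < young_index k G. \<gamma> i \<in> carrier (young_group k)) \<and>
     bij_betw (\<lambda>i. \<gamma> i <#\<^bsub>young_group k\<^esub> G) {..<young_index k G} (lcosets\<^bsub>young_group k\<^esub> G)"

definition inv_ring :: "('r::zero, 'e) ring_scheme \<Rightarrow> nat \<Rightarrow> (nat \<Rightarrow> nat) set \<Rightarrow> 'r mpoly ring" where
  "inv_ring R n H =
    (mpoly_ring R n)\<lparr>carrier := {f \<in> carrier (mpoly_ring R n). \<forall>\<sigma> \<in> H. perm_act \<sigma> f = f}\<rparr>"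

text \<open>
  \<open>R[V]\<^sup>H\<close> as a module, with multiplication as the scalar action. The ring of scalars is not part
  of a module structure; below it is always \<open>R[V]\<^sup>\<Sigma>\<close>.
\<close>

definition inv_module ::
    "('r::zero, 'e) ring_scheme \<Rightarrow> nat \<Rightarrow> (nat \<Rightarrow> nat) set \<Rightarrow> ('r mpoly, 'r mpoly) module" where
  "inv_module R n H =
    \<lparr>carrier = carrier (inv_ring R n H), monoid.mult = monoid.mult (inv_ring R n H),
     one = one (inv_ring R n H), zero = zero (inv_ring R n H), add = add (inv_ring R n H),
     smult = monoid.mult (inv_ring R n H)\<rparr>"


section \<open>Free modules, generators, direct sums\<close>

definition module_basis :: "('a, 'e) ring_scheme \<Rightarrow> ('a, 'b, 'f) module_scheme \<Rightarrow> 'b set \<Rightarrow> bool" where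
  "module_basis S M B \<longleftrightarrow> B \<subseteq> carrier M \<and>
     bij_betw (\<lambda>c. \<Oplus>\<^bsub>M\<^esub>b \<in> {b \<in> B. c b \<noteq> \<zero>\<^bsub>S\<^esub>}. c b \<odot>\<^bsub>M\<^esub> b)
       {c \<in> B \<rightarrow>\<^sub>E carrier S. finite {b \<in> B. c b \<noteq> \<zero>\<^bsub>S\<^esub>}} (carrier M)"

definition free_module :: "('a, 'e) ring_scheme \<Rightarrow> ('a, 'b, 'f) module_scheme \<Rightarrow> bool" where
  "free_module S M \<longleftrightarrow> (\<exists>B. module_basis S M B)"

definition generates ::
    "('a, 'e) ring_scheme \<Rightarrow> ('a, 'b, 'f) module_scheme \<Rightarrow> 'i set \<Rightarrow> ('i \<Rightarrow> 'b) \<Rightarrow> bool" where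
  "generates S M I \<theta> \<longleftrightarrow> \<theta> \<in> I \<rightarrow> carrier M \<and>
     carrier M = {\<Oplus>\<^bsub>M\<^esub>i \<in> I. c i \<odot>\<^bsub>M\<^esub> \<theta> i | c. c \<in> I \<rightarrow> carrier S}"

definition cyclic_submodule ::
    "('a, 'e) ring_scheme \<Rightarrow> ('a, 'b, 'f) module_scheme \<Rightarrow> 'b \<Rightarrow> 'b set" where
  "cyclic_submodule S M v = (\<lambda>c. c \<odot>\<^bsub>M\<^esub> v) ` carrier S"

definition internal_direct_sum ::
    "('a, 'b, 'f) module_scheme \<Rightarrow> 'i set \<Rightarrow> ('i \<Rightarrow> 'b set) \<Rightarrow> bool" where
  "internal_direct_sum M I N \<longleftrightarrow> (\<forall>i \<in> I. N i \<subseteq> carrier M) \<and>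
     bij_betw (\<lambda>h. \<Oplus>\<^bsub>M\<^esub>i \<in> I. h i) (\<Pi>\<^sub>E i \<in> I. N i) (carrier M)"


section \<open>Cohen-Macaulay invariant rings and universal secondaries\<close>

definition cohen_macaulay ::
    "('r::zero, 'e) ring_scheme \<Rightarrow> nat list \<Rightarrow> (nat \<Rightarrow> nat) set \<Rightarrow> bool" where
  "cohen_macaulay R k G \<longleftrightarrow>
     free_module (inv_ring R (sum_list k) (young_subgroup k)) (inv_module R (sum_list k) G)"

text \<open>
  Families are indexed by \<open>0, \<dots>, \<ell> - 1\<close> with \<open>\<ell> = [\<Sigma> : G]\<close>. Minimality is minimality under
  inclusion; it makes \<open>\<theta>\<close> injective on these indices.
\<close>

definition secondaries :: "nat list \<Rightarrow> (nat \<Rightarrow> nat) set \<Rightarrow> (nat \<Rightarrow> rat mpoly) \<Rightarrow> bool" where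
  "secondaries k G \<theta> \<longleftrightarrow>
     (let S = inv_ring class_ring (sum_list k) (young_subgroup k);
          M = inv_module class_ring (sum_list k) G;
          I = {..<young_index k G}
      in (\<forall>i \<in> I. homogeneous (\<theta> i)) \<and> generates S M I \<theta> \<and> (\<forall>J. J \<subset> I \<longrightarrow> \<not> generates S M J \<theta>))"

definition universal_secondaries :: "nat list \<Rightarrow> (nat \<Rightarrow> nat) set \<Rightarrow> (nat \<Rightarrow> int mpoly) \<Rightarrow> bool" where
  "universal_secondaries k G \<theta> \<longleftrightarrow>
     (\<forall>i < young_index k G. \<theta> i \<in> carrier (inv_ring class_ring (sum_list k) G)) \<and>
     secondaries k G (\<lambda>i. to_rat_mpoly (\<theta> i)) \<and>
     (\<forall>p::nat. prime p \<longrightarrow> cohen_macaulay (residue_ring (int p)) k G \<longrightarrow>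
        (let S = inv_ring (residue_ring (int p)) (sum_list k) (young_subgroup k);
             M = inv_module (residue_ring (int p)) (sum_list k) G
         in internal_direct_sum M {..<young_index k G}
              (\<lambda>i. cyclic_submodule S M (reduce_mod p (\<theta> i)))))"

definition secondary_matrix ::
    "nat \<Rightarrow> (nat \<Rightarrow> nat \<Rightarrow> nat) \<Rightarrow> (nat \<Rightarrow> int mpoly) \<Rightarrow> int mpoly mat" where
  "secondary_matrix l \<gamma> \<theta> = mat l l (\<lambda>(i, j). perm_act (\<gamma> i) (\<theta> j))"

text \<open>
  The content of \<open>det M(\<theta>\<^sub>*)\<close>. Another choice of \<open>\<gamma>\<close> changes the determinant at most by a sign when
  the \<open>\<theta> j\<close> are \<open>G\<close>-invariant.
\<close>

definition mho :: "nat list \<Rightarrow> (nat \<Rightarrow> nat) set \<Rightarrow> (nat \<Rightarrow> nat \<Rightarrow> nat) \<Rightarrow> (nat \<Rightarrow> int mpoly) \<Rightarrow> int" where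
  "mho k G \<gamma> \<theta> = mpoly_content (det (secondary_matrix (young_index k G) \<gamma> \<theta>))"


section \<open>Agreement with the types and structures of the library\<close>

lemma perm_act_monomial:
  assumes "bij \<sigma>"
  shows "perm_act \<sigma> (Poly_Mapping.single (Poly_Mapping.single i e) c) =
    Poly_Mapping.single (Poly_Mapping.single (\<sigma> i) e) c"
proof -
  let ?a = "Poly_Mapping.map_key \<sigma> :: (nat \<Rightarrow>\<^sub>0 nat) \<Rightarrow> _"
  have inj: "inj \<sigma>" and surj: "surj \<sigma>"
    using assms by (auto simp: bij_def)
  have inj': "inj ?a"
  proof (rule injI)
    fix x y assume "?a x = ?a y"
    then have "Poly_Mapping.lookup x (\<sigma> j) = Poly_Mapping.lookup y (\<sigma> j)" for j
      using map_key.rep_eq[OF inj] by (metis comp_apply)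
    then show "x = y"
      using surj by (intro poly_mapping_eqI) (metis surjD)
  qed
  have "?a (Poly_Mapping.single (\<sigma> i) e) = Poly_Mapping.single i e"
    by (rule map_key_single[OF inj])
  then show ?thesis
    using map_key_single[OF inj', of "Poly_Mapping.single (\<sigma> i) e" c] by (simp add: perm_act_def)
qed

lemma finite_splittings:
  fixes m :: "nat \<Rightarrow>\<^sub>0 nat"
  shows "finite {ab. fst ab + snd ab = m}"
proof -
  let ?A = "{a. \<forall>i. Poly_Mapping.lookup a i \<le> Poly_Mapping.lookup m i}"
  let ?P = "\<Pi>\<^sub>E i \<in> Poly_Mapping.keys m. {..Poly_Mapping.lookup m i}"
  let ?r = "\<lambda>a. restrict (Poly_Mapping.lookup a) (Poly_Mapping.keys m)"
  have "inj_on ?r ?A"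
  proof (rule inj_onI, rule poly_mapping_eqI)
    fix a b i
    assume a: "a \<in> ?A" and b: "b \<in> ?A" and eq: "?r a = ?r b"
    show "Poly_Mapping.lookup a i = Poly_Mapping.lookup b i"
    proof (cases "i \<in> Poly_Mapping.keys m")
      case True
      then show ?thesis using fun_cong[OF eq, of i] by simp
    next
      case False
      then have "Poly_Mapping.lookup m i = 0" by (simp add: in_keys_iff)
      then show ?thesis using a b by (metis (mono_tags, lifting) le_zero_eq mem_Collect_eq)
    qed
  qed
  moreover have "?r ` ?A \<subseteq> ?P" by auto
  moreover have "finite ?P" by (rule finite_PiE) auto
  ultimately have fin: "finite ?A" by (meson finite_imageD finite_subset)
  have "{ab. fst ab + snd ab = m} \<subseteq> ?A \<times> ?A"
    by (auto simp: lookup_add)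
  then show ?thesis using fin by (meson finite_SigmaI finite_subset)
qed

lemma lookup_mult_splittings:
  fixes f g :: "'r::comm_ring_1 mpoly"
  shows "Poly_Mapping.lookup (f * g) m = (\<Sum>ab \<in> {ab. fst ab + snd ab = m}.
    Poly_Mapping.lookup f (fst ab) * Poly_Mapping.lookup g (snd ab))"
proof -
  let ?f = "Poly_Mapping.lookup f" and ?g = "Poly_Mapping.lookup g"
  let ?P = "Poly_Mapping.keys f \<times> Poly_Mapping.keys g"
  have "Poly_Mapping.lookup (f * g) m =
      (\<Sum>ab. ?f (fst ab) * ?g (snd ab) when m = fst ab + snd ab)"
    unfolding times_poly_mapping.rep_eq
    by (subst prod_fun_unfold_prod) (simp_all add: case_prod_beta)
  also have "\<dots> = (\<Sum>ab \<in> {ab. fst ab + snd ab = m}.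
      ?f (fst ab) * ?g (snd ab) when m = fst ab + snd ab)"
    by (rule Sum_any.expand_superset[OF finite_splittings]) auto
  also have "\<dots> = (\<Sum>ab \<in> {ab. fst ab + snd ab = m}. ?f (fst ab) * ?g (snd ab))"
    by (rule sum.cong) auto
  finally show ?thesis .
qed

lemma mpoly_ring_class_ring:
  fixes f g :: "'r::comm_ring_1 mpoly"
  shows "f \<otimes>\<^bsub>mpoly_ring class_ring n\<^esub> g = f * g"
    and "f \<oplus>\<^bsub>mpoly_ring class_ring n\<^esub> g = f + g"
    and "\<one>\<^bsub>mpoly_ring class_ring n\<^esub> = (1 :: 'r mpoly)"
proof -
  show "f \<otimes>\<^bsub>mpoly_ring class_ring n\<^esub> g = f * g"
    by (simp add: mpoly_ring_def class_ring_simps flip: lookup_mult_splittings)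
  show "f \<oplus>\<^bsub>mpoly_ring class_ring n\<^esub> g = f + g"
    by (simp add: mpoly_ring_def flip: lookup_add)
qed (simp add: mpoly_ring_def)

lemma lookup_reduce_mod:
  "Poly_Mapping.lookup (reduce_mod p f) m = Poly_Mapping.lookup f m mod int p"
  by (simp add: reduce_mod_def map.rep_eq when_def)

lemma mpoly_ring_residue_ring:
  assumes "p > 1"
    and f: "f \<in> carrier (mpoly_ring (residue_ring (int p)) n)"
    and g: "g \<in> carrier (mpoly_ring (residue_ring (int p)) n)"
  shows "f \<otimes>\<^bsub>mpoly_ring (residue_ring (int p)) n\<^esub> g = reduce_mod p (f * g)"
    and "f \<oplus>\<^bsub>mpoly_ring (residue_ring (int p)) n\<^esub> g = reduce_mod p (f + g)"
    and "\<one>\<^bsub>mpoly_ring (residue_ring (int p)) n\<^esub> = 1"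
proof -
  interpret residues "int p" "residue_ring (int p)"
    using assms by unfold_locales auto
  let ?R = "residue_ring (int p)"
  have fc: "Poly_Mapping.lookup f m \<in> carrier ?R" and gc: "Poly_Mapping.lookup g m \<in> carrier ?R" for m
    using f g by (auto simp: mpoly_ring_def)
  have sum: "finite A \<Longrightarrow> u \<in> A \<rightarrow> carrier ?R \<Longrightarrow> (\<Oplus>\<^bsub>?R\<^esub>a\<in>A. u a) = (\<Sum>a\<in>A. u a) mod int p"
    for A and u :: "_ \<Rightarrow> int"
  proof (induction A rule: finite_induct)
    case empty
    then show ?case by (simp add: res_zero_eq)
  next
    case (insert x F)
    then show ?case by (simp add: Pi_iff res_add_eq mod_add_right_eq)
  qed
  have "(\<Oplus>\<^bsub>?R\<^esub>ab \<in> {ab. fst ab + snd ab = m}.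
      Poly_Mapping.lookup f (fst ab) \<otimes>\<^bsub>?R\<^esub> Poly_Mapping.lookup g (snd ab)) =
      Poly_Mapping.lookup (reduce_mod p (f * g)) m" for m
  proof -
    have "(\<lambda>ab. Poly_Mapping.lookup f (fst ab) \<otimes>\<^bsub>?R\<^esub> Poly_Mapping.lookup g (snd ab)) \<in>
        {ab. fst ab + snd ab = m} \<rightarrow> carrier ?R"
      by (intro Pi_I m_closed fc gc)
    from sum[OF finite_splittings this] show ?thesis
      unfolding lookup_reduce_mod lookup_mult_splittings res_mult_eq by (simp only: mod_sum_eq)
  qed
  then show "f \<otimes>\<^bsub>mpoly_ring ?R n\<^esub> g = reduce_mod p (f * g)"
    by (simp add: mpoly_ring_def)
  have "Poly_Mapping.lookup f m \<oplus>\<^bsub>?R\<^esub> Poly_Mapping.lookup g m =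
      Poly_Mapping.lookup (reduce_mod p (f + g)) m" for m
    by (simp add: lookup_reduce_mod lookup_add res_add_eq)
  then show "f \<oplus>\<^bsub>mpoly_ring ?R n\<^esub> g = reduce_mod p (f + g)"
    by (simp add: mpoly_ring_def)
  show "\<one>\<^bsub>mpoly_ring ?R n\<^esub> = 1"
    by (simp add: mpoly_ring_def res_one_eq)
qed

lemma subgroup_young_subgroup: "subgroup (young_subgroup k) (sym_group (sum_list k))"
proof (rule group.subgroupI[OF sym_group_is_group])
  show "young_subgroup k \<subseteq> carrier (sym_group (sum_list k))"
    by (auto simp: young_subgroup_def)
  have "id \<in> young_subgroup k"
    by (simp add: young_subgroup_def sym_group_carrier permutes_id)
  then show "young_subgroup k \<noteq> {}" by blast
next
  fix a assume a: "a \<in> young_subgroup k"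
  then have perm: "a permutes {1..sum_list k}"
    by (simp add: young_subgroup_def sym_group_carrier)
  have "inv\<^bsub>sym_group (sum_list k)\<^esub> a = inv' a"
    using perm by (simp add: sym_group_inv_equality sym_group_carrier)
  moreover have "inv' a ` young_block k i = young_block k i" if "i < length k" for i
  proof -
    have "a ` young_block k i = young_block k i"
      using a that by (simp add: young_subgroup_def)
    then show ?thesis
      using image_inv_f_f[OF permutes_inj[OF perm], of "young_block k i"] by simp
  qed
  ultimately show "inv\<^bsub>sym_group (sum_list k)\<^esub> a \<in> young_subgroup k"
    using perm by (simp add: young_subgroup_def sym_group_carrier permutes_inv)
next
  fix a b assume "a \<in> young_subgroup k" "b \<in> young_subgroup k"
  moreover from this have "(a \<circ> b) ` young_block k i = young_block k i" if "i < length k" for i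
    using that unfolding image_comp[symmetric] by (simp add: young_subgroup_def del: image_comp)
  ultimately show "a \<otimes>\<^bsub>sym_group (sum_list k)\<^esub> b \<in> young_subgroup k"
    by (simp add: young_subgroup_def sym_group_carrier sym_group_mult permutes_compose)
qed

end

theory Submission
  imports Defs
begin

text \<open>
  Let \<open>\<theta>\<^sub>1, \<dots>, \<theta>\<^sub>\<ell>\<close> be universal secondaries and \<open>M = [\<gamma>\<^sub>i \<theta>\<^sub>j]\<close>. A prime \<open>p\<close> divides the content
  of \<open>det M\<close> iff \<open>det M\<close> vanishes in \<open>\<bbbF>\<^sub>p[V]\<close>, so the claim is that \<open>\<bbbF>\<^sub>p[V]\<^sup>G\<close> is free over
  \<open>\<bbbF>\<^sub>p[V]\<^sup>\<Sigma>\<close> iff \<open>det M \<noteq> 0\<close> modulo \<open>p\<close>. Both directions use that \<open>\<Sigma>\<close> fixes the scalars: a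
  linear relation between \<open>G\<close>-invariants remains one, with the same scalars, after applying \<open>\<gamma>\<^sub>i\<close>.

  If \<open>det M \<noteq> 0\<close> modulo \<open>p\<close>, applying all the \<open>\<gamma>\<^sub>i\<close> to a relation \<open>\<Sum> c\<^sub>j \<theta>\<^sub>j = 0\<close> over \<open>\<bbbF>\<^sub>p\<close> gives
  \<open>M c = 0\<close>, hence \<open>c = 0\<close> because \<open>\<bbbF>\<^sub>p[V]\<close> is a domain (\<open>independent_if_not_dvd_det\<close>). To see that
  the \<open>\<theta>\<^sub>j\<close> span, lift an invariant to \<open>\<int>[V]\<^sup>G\<close>. Since the \<open>\<theta>\<^sub>j\<close> generate over \<open>\<rat>\<close>, a positive
  multiple of the lift is an integral combination of them, and for the least such multiple
  independence modulo \<open>p\<close> shows that the factor is prime to \<open>p\<close> (\<open>span_mod_prime\<close>). So the reductions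
  of the \<open>\<theta>\<^sub>j\<close> form a basis.

  Conversely, if \<open>\<bbbF>\<^sub>p[V]\<^sup>G\<close> is free, then universality says that the \<open>\<theta>\<^sub>j\<close> generate it. Then every
  family \<open>f\<^sub>1, \<dots>, f\<^sub>\<ell>\<close> of invariants satisfies \<open>M(f) = M C\<close> modulo \<open>p\<close> for some matrix \<open>C\<close>, so it
  suffices to find one family with \<open>det M(f) \<noteq> 0\<close> (\<open>not_dvd_det_if_span\<close>). Suitable sums of monomials
  over \<open>G\<close>, taken in a regular orbit of \<open>S\<^sub>n\<close>, have a determinant with a coefficient \<open>1\<close>
  (\<open>det_orbit_sums\<close>).
\<close>

abbreviation coef :: "'r::zero mpoly \<Rightarrow> (nat \<Rightarrow>\<^sub>0 nat) \<Rightarrow> 'r" where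
  "coef \<equiv> Poly_Mapping.lookup"

abbreviation const :: "'r::zero \<Rightarrow> 'r mpoly" where
  "const \<equiv> Poly_Mapping.single 0"

section \<open>Leading coefficients modulo a constant\<close>

lemma const_eq_0_iff: "const c = 0 \<longleftrightarrow> c = 0"
proof
  assume "const c = 0"
  then have "coef (const c) 0 = coef 0 0" by (rule arg_cong)
  then show "c = 0" by simp
qed simp

lemma coef_const_mult: "coef (const c * f) m = c * coef f m" for c :: "'r::comm_ring_1"
  by (simp add: map.rep_eq when_def flip: mult_map_scale_conv_mult)

text \<open>
  Reduction modulo \<open>p\<close> is expressed inside \<open>\<int>[V]\<close> throughout, as divisibility by the constant
  polynomial \<open>p\<close>, so that matrices over \<open>\<bbbF>\<^sub>p[V]\<close> become matrices over the type of integral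
  polynomials.
\<close>

lemma const_dvd_iff: "const c dvd f \<longleftrightarrow> (\<forall>m. c dvd coef f m)" for c :: "'r::comm_ring_1"
proof
  assume "const c dvd f"
  then show "\<forall>m. c dvd coef f m"
    by (auto simp: dvd_def coef_const_mult)
next
  assume *: "\<forall>m. c dvd coef f m"
  have "f = const c * Poly_Mapping.map (\<lambda>x. SOME y. x = c * y) f"
  proof (rule poly_mapping_eqI)
    fix m
    have "coef f m = c * (SOME y. coef f m = c * y)"
      using * by (metis (mono_tags, lifting) dvd_def someI_ex)
    then show "coef f m = coef (const c * Poly_Mapping.map (\<lambda>x. SOME y. x = c * y) f) m"
      by (simp add: coef_const_mult map.rep_eq when_def)
  qed
  then show "const c dvd f" by (rule dvdI)
qed

text \<open>
  For a monomial order, \<open>x + y = a + b\<close> with \<open>(x, y) \<noteq> (a, b)\<close> forces \<open>a < x\<close> or \<open>b < y\<close>, so every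
  other contribution to the coefficient at \<open>a + b\<close> vanishes modulo \<open>c\<close>. The case \<open>c = 0\<close> is about
  leading terms proper; the case of a prime \<open>c\<close> is the core of Gauss' lemma.
\<close>

lemma leading_term_mult:
  fixes f g :: "'r::comm_ring_1 mpoly"
  assumes f: "\<And>x. a < x \<Longrightarrow> c dvd coef f x" and g: "\<And>y. b < y \<Longrightarrow> c dvd coef g y"
  shows "c dvd coef (f * g) (a + b) - coef f a * coef g b"
    and "a + b < z \<Longrightarrow> c dvd coef (f * g) z"
proof -
  let ?t = "\<lambda>xy. coef f (fst xy) * coef g (snd xy)"
  have dvd: "c dvd ?t xy" if "a < fst xy \<or> b < snd xy" for xy
    using that f[of "fst xy"] g[of "snd xy"] by (blast intro: dvd_mult dvd_mult2)
  let ?S = "{xy. fst xy + snd xy = a + b}"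
  have "coef (f * g) (a + b) - coef f a * coef g b = (\<Sum>xy \<in> ?S - {(a, b)}. ?t xy)"
    using sum.remove[OF finite_splittings, of "(a, b)" "a + b" ?t] by (simp add: lookup_mult_splittings)
  moreover have "c dvd ?t xy" if "xy \<in> ?S - {(a, b)}" for xy
  proof (rule dvd, rule ccontr)
    assume "\<not> (a < fst xy \<or> b < snd xy)"
    then have le: "fst xy \<le> a" "snd xy \<le> b" by (simp_all add: linorder_not_less)
    have eq: "fst xy + snd xy = a + b" and ne: "xy \<noteq> (a, b)" using that by auto
    have "fst xy \<noteq> a" using eq ne by (cases xy) auto
    then have "fst xy < a" using le(1) by (rule order_neq_le_trans)
    then have "fst xy + snd xy < a + b" using le(2) by (rule add_less_le_mono)
    then show False using eq by (simp only: order_less_irrefl)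
  qed
  ultimately show "c dvd coef (f * g) (a + b) - coef f a * coef g b"
    by (metis (no_types, lifting) dvd_sum)
  show "c dvd coef (f * g) z" if "a + b < z"
    unfolding lookup_mult_splittings
  proof (rule dvd_sum, rule dvd, rule ccontr)
    fix xy assume "xy \<in> {xy. fst xy + snd xy = z}" "\<not> (a < fst xy \<or> b < snd xy)"
    then have "fst xy + snd xy \<le> a + b" and "fst xy + snd xy = z"
      by (auto simp: linorder_not_less intro: add_mono)
    with that show False by (simp add: leD)
  qed
qed

lemma leading_term_prod:
  fixes f :: "'i \<Rightarrow> 'r::comm_ring_1 mpoly"
  assumes "finite I" and "\<And>i x. i \<in> I \<Longrightarrow> a < x \<Longrightarrow> coef (f i) x = 0"
  shows "coef (\<Prod>i\<in>I. f i) (\<Sum>i\<in>I. a) = (\<Prod>i\<in>I. coef (f i) a) \<and>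
    (\<forall>z > (\<Sum>i\<in>I. a). coef (\<Prod>i\<in>I. f i) z = 0)"
  using assms
proof (induction I rule: finite_induct)
  case empty
  then show ?case by (auto simp: lookup_one when_def)
next
  case (insert j I)
  then have IH: "coef (\<Prod>i\<in>I. f i) (\<Sum>i\<in>I. a) = (\<Prod>i\<in>I. coef (f i) a)"
      "\<And>z. (\<Sum>i\<in>I. a) < z \<Longrightarrow> coef (\<Prod>i\<in>I. f i) z = 0"
    and j: "\<And>x. a < x \<Longrightarrow> coef (f j) x = 0"
    by auto
  have 1: "0 dvd coef (f j * (\<Prod>i\<in>I. f i)) (a + (\<Sum>i\<in>I. a)) - coef (f j) a * coef (\<Prod>i\<in>I. f i) (\<Sum>i\<in>I. a)"
    and 2: "a + (\<Sum>i\<in>I. a) < z \<Longrightarrow> 0 dvd coef (f j * (\<Prod>i\<in>I. f i)) z" for z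
    using leading_term_mult[of a 0 "f j" "\<Sum>i\<in>I. a" "\<Prod>i\<in>I. f i"] j IH(2) by (auto simp only: dvd_0_left_iff)
  show ?case
    unfolding sum.insert[OF insert.hyps] prod.insert[OF insert.hyps]
    using 1 2 unfolding IH(1)[symmetric] by (metis dvd_0_left_iff right_minus_eq)
qed

lemma leading_term_exists:
  fixes f :: "'r::comm_ring_1 mpoly"
  assumes "\<not> const c dvd f"
  obtains a where "\<not> c dvd coef f a" "\<And>x. a < x \<Longrightarrow> c dvd coef f x"
proof -
  define K where "K = {m. \<not> c dvd coef f m}"
  have "K \<subseteq> Poly_Mapping.keys f"
  proof
    fix m assume "m \<in> K"
    then have "coef f m \<noteq> 0" by (metis K_def dvd_0_right mem_Collect_eq)
    then show "m \<in> Poly_Mapping.keys f" by (rule in_keys_iff[THEN iffD2])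
  qed
  then have fin: "finite K" by (rule finite_subset) simp
  have "K \<noteq> {}" unfolding K_def using assms const_dvd_iff[of c f] by blast
  then have "Max K \<in> K" by (rule Max_in[OF fin])
  moreover have "x \<notin> K" if "Max K < x" for x
    using Max_ge[OF fin, of x] that leD by blast
  ultimately show thesis using that[of "Max K"] unfolding K_def by blast
qed

text \<open>
  Gauss' lemma: the leading coefficients modulo \<open>p\<close> of two factors are not divisible by \<open>p\<close>, hence
  neither is their product. In other words, \<open>\<bbbF>\<^sub>p[V]\<close> is a domain.
\<close>

lemma prime_elem_const:
  fixes p :: "'r::comm_ring_1"
  assumes p: "prime_elem p"
  shows "prime_elem (const p :: 'r mpoly)"
proof (rule prime_elemI)
  show "const p \<noteq> 0" using p unfolding prime_elem_def const_eq_0_iff by blast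
  show "\<not> const p dvd 1"
  proof
    assume "const p dvd 1"
    then have "\<forall>m. p dvd coef 1 m" by (rule const_dvd_iff[THEN iffD1])
    then have "p dvd coef 1 0" ..
    moreover have "\<not> p dvd 1" using p unfolding prime_elem_def by blast
    ultimately show False by simp
  qed
next
  fix f g :: "'r mpoly"
  assume fg: "const p dvd f * g"
  show "const p dvd f \<or> const p dvd g"
  proof (rule ccontr)
    assume *: "\<not> ?thesis"
    obtain a where a: "\<not> p dvd coef f a" "\<And>x. a < x \<Longrightarrow> p dvd coef f x"
      using leading_term_exists[of p f] * by blast
    obtain b where b: "\<not> p dvd coef g b" "\<And>x. b < x \<Longrightarrow> p dvd coef g x"
      using leading_term_exists[of p g] * by blast
    have "p dvd coef (f * g) (a + b) - coef f a * coef g b"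
      by (rule leading_term_mult(1)[OF a(2) b(2)])
    moreover have "p dvd coef (f * g) (a + b)"
      using fg const_dvd_iff[of p "f * g"] by blast
    ultimately have "p dvd coef (f * g) (a + b) - (coef (f * g) (a + b) - coef f a * coef g b)"
      by (rule dvd_diff[rotated])
    then have "p dvd coef f a * coef g b"
      by simp
    then show False
      using p a(1) b(1) unfolding prime_elem_def by blast
  qed
qed

section \<open>Determinants\<close>

lemma prod_diff_dvd:
  fixes f g :: "'i \<Rightarrow> 'a::comm_ring_1"
  assumes "\<And>i. i \<in> I \<Longrightarrow> c dvd f i - g i"
  shows "c dvd (\<Prod>i\<in>I. f i) - (\<Prod>i\<in>I. g i)"
  using assms
proof (induction I rule: infinite_finite_induct)
  case (insert j I)
  have "(\<Prod>i\<in>insert j I. f i) - (\<Prod>i\<in>insert j I. g i) =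
      f j * ((\<Prod>i\<in>I. f i) - (\<Prod>i\<in>I. g i)) + (f j - g j) * (\<Prod>i\<in>I. g i)"
    using insert.hyps by (simp add: algebra_simps)
  also have "c dvd \<dots>" using insert by (intro dvd_add dvd_mult dvd_mult2) auto
  finally show ?case .
qed auto

lemma det_diff_dvd:
  fixes A B :: "'a::comm_ring_1 mat"
  assumes A: "A \<in> carrier_mat n n" and B: "B \<in> carrier_mat n n"
    and AB: "\<And>i j. i < n \<Longrightarrow> j < n \<Longrightarrow> c dvd A $$ (i, j) - B $$ (i, j)"
  shows "c dvd det A - det B"
proof -
  have "det A - det B = (\<Sum>\<pi> | \<pi> permutes {0..<n}.
      of_int (sign \<pi>) * ((\<Prod>i = 0..<n. A $$ (i, \<pi> i)) - (\<Prod>i = 0..<n. B $$ (i, \<pi> i))))"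
    unfolding det_def'[OF A] det_def'[OF B] by (simp add: sum_subtractf algebra_simps)
  also have "c dvd \<dots>"
    by (intro dvd_sum dvd_mult prod_diff_dvd AB) (auto simp: permutes_in_image)
  finally show ?thesis .
qed

text \<open>
  Cramer's rule modulo \<open>c\<close>: multiplying \<open>A v \<equiv> 0\<close> by the adjugate gives \<open>det A \<cdot> v \<equiv> 0\<close>.
\<close>

lemma det_mult_dvd:
  fixes A :: "'a::comm_ring_1 mat"
  assumes A: "A \<in> carrier_mat n n"
    and Av: "\<And>i. i < n \<Longrightarrow> c dvd (\<Sum>j<n. A $$ (i, j) * v j)" and j: "j < n"
  shows "c dvd det A * v j"
proof -
  note adj = adj_mat[OF A]
  have "adj_mat A *\<^sub>v (A *\<^sub>v vec n v) = det A \<cdot>\<^sub>v vec n v"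
    by (subst assoc_mult_mat_vec[OF adj(1) A, symmetric]) (use adj in auto)
  then have "det A * v j = (adj_mat A *\<^sub>v (A *\<^sub>v vec n v)) $ j"
    using j by simp
  also have "\<dots> = (\<Sum>i<n. adj_mat A $$ (j, i) * (\<Sum>j<n. A $$ (i, j) * v j))"
    using A adj(1) j by (auto simp: scalar_prod_def atLeast0LessThan intro!: sum.cong)
  also have "c dvd \<dots>"
    by (intro dvd_sum dvd_mult Av) auto
  finally show ?thesis .
qed

text \<open>
  If no entry has a monomial above \<open>a\<close>, then taking the coefficient at \<open>a\<close> is multiplicative on the
  products in the Leibniz formula, hence commutes with the determinant. The sum of \<open>n\<close> copies of
  \<open>a\<close> is the monomial \<open>a\<^sup>n\<close>, written additively.
\<close>

lemma coef_det:
  fixes A :: "'r::comm_ring_1 mpoly mat"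
  assumes A: "A \<in> carrier_mat n n"
    and top: "\<And>i j x. i < n \<Longrightarrow> j < n \<Longrightarrow> a < x \<Longrightarrow> coef (A $$ (i, j)) x = 0"
  shows "coef (det A) (\<Sum>i = 0..<n. a) = det (mat n n (\<lambda>(i, j). coef (A $$ (i, j)) a))"
proof -
  have sgn: "coef (of_int s * f) m = of_int s * coef f m" for s :: int and f :: "'r mpoly" and m
    by (metis coef_const_mult single_of_int)
  have "coef (\<Prod>i = 0..<n. A $$ (i, \<pi> i)) (\<Sum>i = 0..<n. a) = (\<Prod>i = 0..<n. coef (A $$ (i, \<pi> i)) a)"
    if "\<pi> permutes {0..<n}" for \<pi>
    using that by (intro leading_term_prod[THEN conjunct1] top) (auto simp: permutes_in_image)
  then show ?thesis
    by (auto simp: det_def'[OF A] det_def'[OF mat_carrier] lookup_sum sgn permutes_in_image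
        simp del: sum_constant intro!: sum.cong prod.cong)
qed

section \<open>The permutation action and invariant polynomials\<close>

lemma map_key_inv_cancel:
  assumes "bij \<sigma>"
  shows "Poly_Mapping.map_key \<sigma> (Poly_Mapping.map_key (inv' \<sigma>) m) = m"
    and "Poly_Mapping.map_key (inv' \<sigma>) (Poly_Mapping.map_key \<sigma> m) = m"
  using assms bij_imp_bij_inv[OF assms] map_key_id[of m]
  by (simp_all add: map_key_compose bij_is_inj bij_is_surj id_def[symmetric] surj_iff[THEN iffD1])

lemma inj_map_key:
  fixes \<sigma> :: "'a \<Rightarrow> 'a"
  assumes "bij \<sigma>"
  shows "inj (Poly_Mapping.map_key \<sigma>)"
  by (rule inj_on_inverseI) (rule map_key_inv_cancel(2)[OF assms])

lemma coef_perm_act: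
  assumes "bij \<sigma>"
  shows "coef (perm_act \<sigma> f) m = coef f (Poly_Mapping.map_key \<sigma> m)"
  by (simp add: perm_act_def map_key.rep_eq[OF inj_map_key[OF assms]])

lemma perm_act_single:
  assumes "bij \<sigma>"
  shows "perm_act \<sigma> (Poly_Mapping.single m c) = Poly_Mapping.single (Poly_Mapping.map_key (inv' \<sigma>) m) c"
  unfolding perm_act_def
  using map_key_single[OF inj_map_key[OF assms], of "Poly_Mapping.map_key (inv' \<sigma>) m" c]
  by (simp add: map_key_inv_cancel[OF assms])

lemma perm_act_const: "bij \<sigma> \<Longrightarrow> perm_act \<sigma> (const c) = const c"
  by (simp add: perm_act_single map_key_zero bij_is_inj bij_imp_bij_inv)

lemma perm_act_add: "bij \<sigma> \<Longrightarrow> perm_act \<sigma> (f + g) = perm_act \<sigma> f + perm_act \<sigma> g"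
  by (rule poly_mapping_eqI) (simp add: coef_perm_act lookup_add)

lemma perm_act_sum:
  assumes "bij \<sigma>"
  shows "perm_act \<sigma> (\<Sum>i\<in>A. f i) = (\<Sum>i\<in>A. perm_act \<sigma> (f i))"
  by (rule poly_mapping_eqI) (simp add: coef_perm_act assms lookup_sum)

lemma perm_act_map:
  "bij \<sigma> \<Longrightarrow> perm_act \<sigma> (Poly_Mapping.map h f) = Poly_Mapping.map h (perm_act \<sigma> f)"
  unfolding perm_act_def by (rule map_key_map[OF inj_map_key])

lemma perm_act_mult:
  fixes f g :: "'r::comm_ring_1 mpoly"
  assumes \<sigma>: "bij \<sigma>"
  shows "perm_act \<sigma> (f * g) = perm_act \<sigma> f * perm_act \<sigma> g"
proof (rule poly_mapping_eqI)
  fix m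
  let ?a = "Poly_Mapping.map_key \<sigma> :: (nat \<Rightarrow>\<^sub>0 nat) \<Rightarrow> _"
  let ?b = "Poly_Mapping.map_key (inv' \<sigma>) :: (nat \<Rightarrow>\<^sub>0 nat) \<Rightarrow> _"
  have plus: "?a (x + y) = ?a x + ?a y" "?b (x + y) = ?b x + ?b y" for x y
    using \<sigma> by (simp_all add: map_key_plus bij_is_inj bij_imp_bij_inv)
  note inv = map_key_inv_cancel[OF \<sigma>]
  show "coef (perm_act \<sigma> (f * g)) m = coef (perm_act \<sigma> f * perm_act \<sigma> g) m"
    unfolding lookup_mult_splittings coef_perm_act[OF \<sigma>]
    by (rule sum.reindex_bij_witness[of _ "map_prod ?a ?a" "map_prod ?b ?b"])
      (auto simp: inv plus simp flip: plus)
qed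

lemma perm_act_dvd:
  fixes f g :: "'r::comm_ring_1 mpoly"
  shows "bij \<sigma> \<Longrightarrow> const c dvd f \<Longrightarrow> const c dvd perm_act \<sigma> f"
  by (auto simp: perm_act_mult perm_act_const elim!: dvdE)

text \<open>
  The set \<open>R[V]\<^sup>H\<close>, independent of any ring structure on the coefficients. An element of
  \<open>\<bbbF>\<^sub>p[V]\<^sup>H\<close>, with its coefficients in \<open>{0..<p}\<close>, literally is an element of \<open>\<int>[V]\<^sup>H\<close>, so
  that invariants lift from \<open>\<bbbF>\<^sub>p\<close> to \<open>\<int>\<close> without further argument.
\<close>

definition invariants :: "nat \<Rightarrow> (nat \<Rightarrow> nat) set \<Rightarrow> 'r::zero mpoly set" where
  "invariants n H = {f. (\<forall>m \<in> Poly_Mapping.keys f. Poly_Mapping.keys m \<subseteq> {1..n}) \<and>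
     (\<forall>\<sigma> \<in> H. perm_act \<sigma> f = f)}"

lemma invariants_antimono: "H \<subseteq> K \<Longrightarrow> invariants n K \<subseteq> invariants n H"
  by (auto simp: invariants_def)

locale permutations =
  fixes H :: "(nat \<Rightarrow> nat) set"
  assumes bij: "\<sigma> \<in> H \<Longrightarrow> bij \<sigma>"
begin

lemma invariants_const: "const c \<in> invariants n H"
  by (auto simp: invariants_def perm_act_const bij)

lemma invariants_zero: "0 \<in> invariants n H"
  using invariants_const[of 0] by simp

lemma invariants_one: "(1 :: 'r::comm_ring_1 mpoly) \<in> invariants n H"
  using invariants_const[of "1 :: 'r"] by simp

lemma invariants_add: "f \<in> invariants n H \<Longrightarrow> g \<in> invariants n H \<Longrightarrow> f + g \<in> invariants n H"
  using keys_add[of f g] unfolding invariants_def by (auto simp only: mem_Collect_eq perm_act_add bij) blast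

lemma invariants_sum:
  "(\<And>i. i \<in> A \<Longrightarrow> f i \<in> invariants n H) \<Longrightarrow> (\<Sum>i\<in>A. f i) \<in> invariants n H"
  using invariants_zero
  by (induction A rule: infinite_finite_induct) (auto intro: invariants_add)

lemma invariants_mult:
  fixes f g :: "'r::comm_ring_1 mpoly"
  assumes "f \<in> invariants n H" "g \<in> invariants n H"
  shows "f * g \<in> invariants n H"
proof -
  have "Poly_Mapping.keys m \<subseteq> {1..n}" if m: "m \<in> Poly_Mapping.keys (f * g)" for m
  proof -
    obtain a b where "m = a + b" "a \<in> Poly_Mapping.keys f" "b \<in> Poly_Mapping.keys g"
      using keys_mult[of f g] m by blast
    then show ?thesis
      using assms keys_add[of a b] unfolding invariants_def by blast
  qed
  then show ?thesis
    using assms by (simp add: invariants_def perm_act_mult bij)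
qed

lemma invariants_minus:
  fixes f g :: "'r::comm_ring_1 mpoly"
  assumes "f \<in> invariants n H" "g \<in> invariants n H"
  shows "f - g \<in> invariants n H"
  using invariants_add[OF assms(1) invariants_mult[OF invariants_const[of "-1"] assms(2)]]
  by (simp add: single_uminus)

lemma invariants_map:
  assumes "f \<in> invariants n H"
  shows "Poly_Mapping.map h f \<in> invariants n H"
proof -
  have "Poly_Mapping.keys (Poly_Mapping.map h f) \<subseteq> Poly_Mapping.keys f"
    by (auto simp: in_keys_iff map.rep_eq)
  then show ?thesis
    using assms by (auto simp: invariants_def perm_act_map bij)
qed

end

section \<open>Reduction modulo a prime\<close>

text \<open>
  Constants \<open>const (int p)\<close> are to stay in this form, in which the lemmas on divisibility apply.
\<close>

declare single_of_nat [simp del] single_of_int [simp del]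

lemma reduce_mod_eq_iff: "reduce_mod p f = reduce_mod p g \<longleftrightarrow> const (int p) dvd f - g"
  unfolding const_dvd_iff poly_mapping_eq_iff fun_eq_iff
  by (simp add: lookup_reduce_mod mod_eq_dvd_iff lookup_minus)

lemma dvd_reduce_mod_minus: "const (int p) dvd reduce_mod p f - f"
  unfolding const_dvd_iff
  by (auto simp: lookup_reduce_mod lookup_minus simp flip: mod_eq_dvd_iff)

lemma reduce_mod_idem [simp]: "reduce_mod p (reduce_mod p f) = reduce_mod p f"
  by (rule poly_mapping_eqI) (simp add: lookup_reduce_mod)

lemma reduce_mod_zero [simp]: "reduce_mod p 0 = 0"
  by (rule poly_mapping_eqI) (simp add: lookup_reduce_mod)

lemma reduce_mod_add_reduce_mod:
  "reduce_mod p (reduce_mod p f + g) = reduce_mod p (f + g)"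
  "reduce_mod p (f + reduce_mod p g) = reduce_mod p (f + g)"
  by (rule poly_mapping_eqI, simp add: lookup_reduce_mod lookup_add mod_simps)+

lemma reduce_mod_sum_cong:
  assumes "\<And>i. i \<in> A \<Longrightarrow> const (int p) dvd f i - g i"
  shows "reduce_mod p (\<Sum>i\<in>A. f i) = reduce_mod p (\<Sum>i\<in>A. g i)"
  unfolding reduce_mod_eq_iff sum_subtractf[symmetric] by (intro dvd_sum assms)

lemma dvd_mult_reduce_mod_minus:
  "const (int p) dvd reduce_mod p c * f - c * f" "const (int p) dvd c * reduce_mod p f - c * f"
  unfolding left_diff_distrib[symmetric] right_diff_distrib[symmetric]
  by (intro dvd_mult dvd_mult2 dvd_reduce_mod_minus)+

lemma (in permutations) invariants_reduce_mod:
  "f \<in> invariants n H \<Longrightarrow> reduce_mod p f \<in> invariants n H"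
  unfolding reduce_mod_def by (rule invariants_map)

section \<open>Invariant rings as modules\<close>

lemma carrier_inv_ring_class_ring: "carrier (inv_ring class_ring n H) = invariants n H"
  by (auto simp: inv_ring_def mpoly_ring_def invariants_def)

lemma carrier_inv_ring_residue_ring:
  assumes "p > 1"
  shows "carrier (inv_ring (residue_ring (int p)) n H) = {f \<in> invariants n H. reduce_mod p f = f}"
proof -
  have "(\<forall>m. coef f m \<in> carrier (residue_ring (int p))) \<longleftrightarrow> reduce_mod p f = f" for f
    using assms unfolding poly_mapping_eq_iff fun_eq_iff
    by (auto simp: residue_ring_def lookup_reduce_mod zmod_trivial_iff)
  then show ?thesis
    by (auto simp: inv_ring_def mpoly_ring_def invariants_def)
qed

lemma inv_module_simps:
  "carrier (inv_module R n H) = carrier (inv_ring R n H)"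
  "zero (inv_module R n H) = 0"
  "zero (inv_ring R n H) = 0"
  "add (inv_module R n H) = add (mpoly_ring R n)"
  "smult (inv_module R n H) = monoid.mult (mpoly_ring R n)"
  by (simp_all add: inv_module_def inv_ring_def mpoly_ring_def)

context permutations
begin

lemma finsum_inv_module_class_ring:
  fixes h :: "'i \<Rightarrow> 'r::comm_ring_1 mpoly"
  assumes "finite A" and "h \<in> A \<rightarrow> invariants n H"
  shows "(\<Oplus>\<^bsub>inv_module class_ring n H\<^esub>i\<in>A. h i) = (\<Sum>i\<in>A. h i)"
proof -
  let ?M = "inv_module class_ring n H :: ('r mpoly, 'r mpoly) module"
  note simps = inv_module_simps carrier_inv_ring_class_ring mpoly_ring_class_ring
  interpret abelian_monoid ?M
    by (rule abelian_monoidI)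
      (auto simp: simps add.assoc add.commute invariants_add invariants_zero)
  show ?thesis
    using assms
    by (induction A rule: finite_induct)
      (auto simp: simps Pi_iff)
qed

lemma finsum_inv_module_residue_ring:
  assumes p: "p > 1" and "finite A" and "h \<in> A \<rightarrow> carrier (inv_module (residue_ring (int p)) n H)"
  shows "(\<Oplus>\<^bsub>inv_module (residue_ring (int p)) n H\<^esub>i\<in>A. h i) = reduce_mod p (\<Sum>i\<in>A. h i)"
proof -
  let ?R = "residue_ring (int p)"
  let ?M = "inv_module ?R n H"
  have M: "carrier ?M = {f \<in> invariants n H. reduce_mod p f = f}"
    by (simp add: inv_module_simps carrier_inv_ring_residue_ring[OF p])
  have "carrier ?M \<subseteq> carrier (mpoly_ring ?R n)"
    by (auto simp: inv_module_def inv_ring_def)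
  then have add: "f \<oplus>\<^bsub>?M\<^esub> g = reduce_mod p (f + g)" if "f \<in> carrier ?M" "g \<in> carrier ?M" for f g
    using that mpoly_ring_residue_ring(2)[OF p] unfolding inv_module_simps by blast
  have closed: "f \<oplus>\<^bsub>?M\<^esub> g \<in> carrier ?M" if "f \<in> carrier ?M" "g \<in> carrier ?M" for f g
    using that unfolding add[OF that] M by (auto intro: invariants_reduce_mod invariants_add)
  have zero: "\<zero>\<^bsub>?M\<^esub> \<in> carrier ?M" unfolding M inv_module_simps(2)
    using invariants_zero by simp
  interpret abelian_monoid ?M
  proof (rule abelian_monoidI)
    fix x y z assume *: "x \<in> carrier ?M" "y \<in> carrier ?M" "z \<in> carrier ?M"
    show "x \<oplus>\<^bsub>?M\<^esub> y \<oplus>\<^bsub>?M\<^esub> z = x \<oplus>\<^bsub>?M\<^esub> (y \<oplus>\<^bsub>?M\<^esub> z)"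
      using * closed by (simp add: add reduce_mod_add_reduce_mod add.assoc)
  next
    fix x y assume *: "x \<in> carrier ?M" "y \<in> carrier ?M"
    show "x \<oplus>\<^bsub>?M\<^esub> y = y \<oplus>\<^bsub>?M\<^esub> x"
      using * by (simp add: add add.commute)
  next
    fix x assume *: "x \<in> carrier ?M"
    then show "\<zero>\<^bsub>?M\<^esub> \<oplus>\<^bsub>?M\<^esub> x = x"
      using add[OF zero *] by (simp add: M inv_module_simps(2))
  qed (fact closed zero)+
  show ?thesis
    using assms(2,3)
  proof (induction A rule: finite_induct)
    case empty
    then show ?case by (simp add: inv_module_simps(2))
  next
    case (insert a A)
    then have "h a \<in> carrier ?M" "h \<in> A \<rightarrow> carrier ?M" by auto
    then have "(\<Oplus>\<^bsub>?M\<^esub>i\<in>insert a A. h i) = reduce_mod p (h a + (\<Oplus>\<^bsub>?M\<^esub>i\<in>A. h i))"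
      using insert.hyps by (simp add: add)
    with insert show ?case by (simp add: reduce_mod_add_reduce_mod)
  qed
qed

lemma smult_inv_module_residue_ring:
  assumes p: "p > 1" and "H \<subseteq> K"
    and c: "c \<in> carrier (inv_ring (residue_ring (int p)) n K)"
    and f: "f \<in> carrier (inv_module (residue_ring (int p)) n H)"
  shows "c \<odot>\<^bsub>inv_module (residue_ring (int p)) n H\<^esub> f = reduce_mod p (c * f)"
    and "c \<odot>\<^bsub>inv_module (residue_ring (int p)) n H\<^esub> f \<in> carrier (inv_module (residue_ring (int p)) n H)"
proof -
  show 1: "c \<odot>\<^bsub>inv_module (residue_ring (int p)) n H\<^esub> f = reduce_mod p (c * f)"
    using mpoly_ring_residue_ring(1)[OF p] c f unfolding inv_module_simps
    by (auto simp: inv_ring_def)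
  have "c \<in> invariants n H" "f \<in> invariants n H"
    using c f invariants_antimono[OF assms(2), of n]
    by (auto simp: inv_module_simps carrier_inv_ring_residue_ring[OF p])
  then show "c \<odot>\<^bsub>inv_module (residue_ring (int p)) n H\<^esub> f \<in> carrier (inv_module (residue_ring (int p)) n H)"
    unfolding 1 unfolding inv_module_simps(1) carrier_inv_ring_residue_ring[OF p]
    by (auto intro: invariants_mult invariants_reduce_mod)
qed

text \<open>
  Linear combinations over \<open>\<bbbF>\<^sub>p[V]\<^sup>K\<close> can be computed in \<open>\<int>[V]\<close> and reduced once, at the end.
\<close>

lemma linear_combination_residue_ring:
  assumes p: "p > 1" and HK: "H \<subseteq> K" and A: "finite A"
    and c: "\<And>i. i \<in> A \<Longrightarrow> c i \<in> carrier (inv_ring (residue_ring (int p)) n K)"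
    and f: "\<And>i. i \<in> A \<Longrightarrow> f i \<in> carrier (inv_module (residue_ring (int p)) n H)"
  shows "(\<Oplus>\<^bsub>inv_module (residue_ring (int p)) n H\<^esub>i\<in>A. c i \<odot>\<^bsub>inv_module (residue_ring (int p)) n H\<^esub> f i) =
    reduce_mod p (\<Sum>i\<in>A. c i * f i)"
proof -
  note sm = smult_inv_module_residue_ring[OF p HK c f]
  have "(\<Oplus>\<^bsub>inv_module (residue_ring (int p)) n H\<^esub>i\<in>A. c i \<odot>\<^bsub>inv_module (residue_ring (int p)) n H\<^esub> f i) =
      reduce_mod p (\<Sum>i\<in>A. c i \<odot>\<^bsub>inv_module (residue_ring (int p)) n H\<^esub> f i)"
    by (rule finsum_inv_module_residue_ring[OF p A]) (auto intro: sm)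
  also have "(\<Sum>i\<in>A. c i \<odot>\<^bsub>inv_module (residue_ring (int p)) n H\<^esub> f i) = (\<Sum>i\<in>A. reduce_mod p (c i * f i))"
    by (rule sum.cong) (auto simp: sm)
  also have "reduce_mod p \<dots> = reduce_mod p (\<Sum>i\<in>A. c i * f i)"
    unfolding reduce_mod_eq_iff sum_subtractf[symmetric]
    by (intro dvd_sum dvd_reduce_mod_minus)
  finally show ?thesis .
qed

end

section \<open>Independence modulo a prime and freeness\<close>

text \<open>
  Freeness in terms of integral polynomials: integral invariants that span modulo \<open>p\<close>, and whose
  only relations modulo \<open>p\<close> are the trivial ones, reduce to a basis of \<open>\<bbbF>\<^sub>p[V]\<^sup>H\<close>. Independence
  also makes the reductions distinct, so the family can be replaced by its image.
\<close>

lemma (in permutations) module_basis_reduce_mod: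
  fixes t :: "'i \<Rightarrow> int mpoly"
  assumes p: "p > 1" and HK: "H \<subseteq> K" and K: "\<And>\<sigma>. \<sigma> \<in> K \<Longrightarrow> bij \<sigma>" and I: "finite I"
    and t: "\<And>i. i \<in> I \<Longrightarrow> t i \<in> invariants n H"
    and span: "\<And>f. f \<in> invariants n H \<Longrightarrow>
      \<exists>c. (\<forall>i\<in>I. c i \<in> invariants n K) \<and> const (int p) dvd f - (\<Sum>i\<in>I. c i * t i)"
    and indep: "\<And>c j. (\<And>i. i \<in> I \<Longrightarrow> c i \<in> invariants n K) \<Longrightarrow>
      const (int p) dvd (\<Sum>i\<in>I. c i * t i) \<Longrightarrow> j \<in> I \<Longrightarrow> const (int p) dvd c j"
  shows "module_basis (inv_ring (residue_ring (int p)) n K) (inv_module (residue_ring (int p)) n H)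
    ((\<lambda>i. reduce_mod p (t i)) ` I)"
proof -
  interpret K: permutations K by standard (rule K)
  let ?P = "const (int p)"
  let ?S = "inv_ring (residue_ring (int p)) n K"
  let ?M = "inv_module (residue_ring (int p)) n H"
  have S: "carrier ?S = {f \<in> invariants n K. reduce_mod p f = f}"
    by (rule carrier_inv_ring_residue_ring[OF p])
  have M: "carrier ?M = {f \<in> invariants n H. reduce_mod p f = f}"
    by (simp add: inv_module_simps carrier_inv_ring_residue_ring[OF p])
  define u where "u = (\<lambda>i. reduce_mod p (t i))"
  let ?B = "u ` I"
  have u: "u i \<in> carrier ?M" if "i \<in> I" for i
    using t[OF that] by (simp add: u_def M invariants_reduce_mod)
  have inj: "inj_on u I"
  proof (rule inj_onI, rule ccontr)
    fix i j assume ij: "i \<in> I" "j \<in> I" "u i = u j" "i \<noteq> j"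
    \<comment> \<open>\<open>u i = u j\<close> is the relation \<open>t i - t j \<equiv> 0\<close>, and its coefficient \<open>1\<close> is not divisible by \<open>p\<close>\<close>
    define c where "c l = (if l = i then 1 else if l = j then - 1 else 0 :: int mpoly)" for l
    have "c l \<in> invariants n K" for l
      by (auto simp: c_def intro: K.invariants_zero K.invariants_one
          K.invariants_minus[OF K.invariants_zero K.invariants_one, simplified])
    moreover have "(\<Sum>l\<in>I. c l * t l) = t i - t j"
    proof -
      have "(\<Sum>l\<in>I. c l * t l) = (\<Sum>l\<in>{i, j}. c l * t l)"
        by (rule sum.mono_neutral_right[OF I]) (use ij in \<open>auto simp: c_def\<close>)
      then show ?thesis using ij by (simp add: c_def)
    qed
    moreover have "?P dvd t i - t j"
      using ij by (simp add: u_def reduce_mod_eq_iff)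
    ultimately have "?P dvd c i" using indep[of c i] ij by simp
    then have "?P dvd 1" by (simp add: c_def)
    then have "int p dvd coef 1 0" using const_dvd_iff by blast
    then show False using p by simp
  qed
  have comb: "(\<Oplus>\<^bsub>?M\<^esub>b \<in> {b \<in> ?B. c b \<noteq> \<zero>\<^bsub>?S\<^esub>}. c b \<odot>\<^bsub>?M\<^esub> b) = reduce_mod p (\<Sum>i\<in>I. c (u i) * t i)"
    if c: "c \<in> ?B \<rightarrow>\<^sub>E carrier ?S" for c
  proof -
    have "(\<Oplus>\<^bsub>?M\<^esub>b \<in> {b \<in> ?B. c b \<noteq> \<zero>\<^bsub>?S\<^esub>}. c b \<odot>\<^bsub>?M\<^esub> b) =
        reduce_mod p (\<Sum>b \<in> {b \<in> ?B. c b \<noteq> \<zero>\<^bsub>?S\<^esub>}. c b * b)"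
      by (rule linear_combination_residue_ring[OF p HK]) (use c u I in auto)
    also have "(\<Sum>b \<in> {b \<in> ?B. c b \<noteq> \<zero>\<^bsub>?S\<^esub>}. c b * b) = (\<Sum>b\<in>?B. c b * b)"
      by (rule sum.mono_neutral_left) (use I in \<open>auto simp: inv_module_simps(3)\<close>)
    also have "\<dots> = (\<Sum>i\<in>I. c (u i) * u i)"
      by (simp add: sum.reindex[OF inj])
    also have "reduce_mod p \<dots> = reduce_mod p (\<Sum>i\<in>I. c (u i) * t i)"
      unfolding u_def by (intro reduce_mod_sum_cong dvd_mult_reduce_mod_minus)
    finally show ?thesis .
  qed
  have fin: "{c \<in> ?B \<rightarrow>\<^sub>E carrier ?S. finite {b \<in> ?B. c b \<noteq> \<zero>\<^bsub>?S\<^esub>}} = ?B \<rightarrow>\<^sub>E carrier ?S"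
    using I by auto
  have "bij_betw (\<lambda>c. \<Oplus>\<^bsub>?M\<^esub>b \<in> {b \<in> ?B. c b \<noteq> \<zero>\<^bsub>?S\<^esub>}. c b \<odot>\<^bsub>?M\<^esub> b) (?B \<rightarrow>\<^sub>E carrier ?S) (carrier ?M)"
    (is "bij_betw ?F _ _")
  proof (rule bij_betw_imageI)
    show "inj_on ?F (?B \<rightarrow>\<^sub>E carrier ?S)"
    proof (rule inj_onI)
      fix c d assume c: "c \<in> ?B \<rightarrow>\<^sub>E carrier ?S" and d: "d \<in> ?B \<rightarrow>\<^sub>E carrier ?S"
        and eq: "(\<Oplus>\<^bsub>?M\<^esub>b \<in> {b \<in> ?B. c b \<noteq> \<zero>\<^bsub>?S\<^esub>}. c b \<odot>\<^bsub>?M\<^esub> b) =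
          (\<Oplus>\<^bsub>?M\<^esub>b \<in> {b \<in> ?B. d b \<noteq> \<zero>\<^bsub>?S\<^esub>}. d b \<odot>\<^bsub>?M\<^esub> b)"
      have "?P dvd (\<Sum>i\<in>I. (c (u i) - d (u i)) * t i)"
        using eq unfolding comb[OF c] comb[OF d] reduce_mod_eq_iff
        by (simp add: sum_subtractf left_diff_distrib)
      moreover have cd: "c (u i) \<in> carrier ?S" "d (u i) \<in> carrier ?S" if "i \<in> I" for i
        using c d that by auto
      ultimately have dvd: "?P dvd c (u i) - d (u i)" if "i \<in> I" for i
        by (intro indep[where c = "\<lambda>i. c (u i) - d (u i)"] that K.invariants_minus) (simp_all add: S)
      show "c = d"
      proof (rule PiE_ext[OF c d])
        fix b assume "b \<in> ?B"
        then obtain i where i: "i \<in> I" "b = u i" by blast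
        then show "c b = d b"
          using dvd[OF i(1)] cd[OF i(1)] by (simp add: S flip: reduce_mod_eq_iff)
      qed
    qed
    show "?F ` (?B \<rightarrow>\<^sub>E carrier ?S) = carrier ?M"
    proof (intro equalityI subsetI)
      fix f assume "f \<in> ?F ` (?B \<rightarrow>\<^sub>E carrier ?S)"
      then obtain c where c: "c \<in> ?B \<rightarrow>\<^sub>E carrier ?S" and f: "f = reduce_mod p (\<Sum>i\<in>I. c (u i) * t i)"
        using comb by auto
      have "c (u i) * t i \<in> invariants n H" if "i \<in> I" for i
        using c t[OF that] that invariants_antimono[OF HK, of n]
        by (intro invariants_mult) (auto simp: S PiE_iff)
      then show "f \<in> carrier ?M"
        unfolding M by (simp add: f invariants_reduce_mod invariants_sum)
    next
      fix f assume "f \<in> carrier ?M"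
      then have f: "f \<in> invariants n H" "reduce_mod p f = f" by (auto simp: M)
      obtain d where d: "\<And>i. i \<in> I \<Longrightarrow> d i \<in> invariants n K" "?P dvd f - (\<Sum>i\<in>I. d i * t i)"
        using span[OF f(1)] by blast
      define c where "c = (\<lambda>b\<in>?B. reduce_mod p (d (inv_into I u b)))"
      have cu: "c (u i) = reduce_mod p (d i)" if "i \<in> I" for i
        using that by (simp add: c_def inv_into_f_f[OF inj])
      have c: "c \<in> ?B \<rightarrow>\<^sub>E carrier ?S"
      proof (rule PiE_I)
        fix b assume "b \<in> ?B"
        then show "c b \<in> carrier ?S"
          using cu d(1) by (auto simp: S K.invariants_reduce_mod)
      qed (auto simp: c_def)
      have "f = reduce_mod p (\<Sum>i\<in>I. d i * t i)"
        using d(2) f(2) unfolding reduce_mod_eq_iff[symmetric] by simp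
      also have "\<dots> = reduce_mod p (\<Sum>i\<in>I. c (u i) * t i)"
        by (rule sym, rule reduce_mod_sum_cong) (simp add: cu dvd_mult_reduce_mod_minus)
      finally have "f = reduce_mod p (\<Sum>i\<in>I. c (u i) * t i)" .
      then have "f = ?F c" by (simp only: comb[OF c])
      then show "f \<in> ?F ` (?B \<rightarrow>\<^sub>E carrier ?S)"
        using c by (rule image_eqI)
    qed
  qed
  then show ?thesis
    using u unfolding module_basis_def fin[unfolded u_def] u_def by auto
qed

text \<open>
  A decomposition of \<open>\<bbbF>\<^sub>p[V]\<^sup>H\<close> into cyclic submodules lets a generator be zero; it says that the
  generators span, but not that they are independent.
\<close>

lemma (in permutations) internal_direct_sum_span:
  fixes t :: "'i \<Rightarrow> int mpoly"
  assumes p: "p > 1" and HK: "H \<subseteq> K" and I: "finite I"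
    and t: "\<And>i. i \<in> I \<Longrightarrow> t i \<in> invariants n H"
    and sum: "internal_direct_sum (inv_module (residue_ring (int p)) n H) I
      (\<lambda>i. cyclic_submodule (inv_ring (residue_ring (int p)) n K) (inv_module (residue_ring (int p)) n H)
        (reduce_mod p (t i)))"
    and f: "f \<in> invariants n H"
  shows "\<exists>c. (\<forall>i\<in>I. c i \<in> invariants n K) \<and> const (int p) dvd f - (\<Sum>i\<in>I. c i * t i)"
proof -
  let ?S = "inv_ring (residue_ring (int p)) n K"
  let ?M = "inv_module (residue_ring (int p)) n H"
  let ?u = "\<lambda>i. reduce_mod p (t i)"
  have M: "carrier ?M = {f \<in> invariants n H. reduce_mod p f = f}"
    by (simp add: inv_module_simps carrier_inv_ring_residue_ring[OF p])
  have "reduce_mod p f \<in> carrier ?M" using f by (simp add: M invariants_reduce_mod)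
  then obtain h where h: "h \<in> (\<Pi>\<^sub>E i\<in>I. cyclic_submodule ?S ?M (?u i))"
    and fh: "reduce_mod p f = (\<Oplus>\<^bsub>?M\<^esub>i\<in>I. h i)"
    using sum unfolding internal_direct_sum_def bij_betw_def by blast
  have "\<forall>i\<in>I. \<exists>c\<in>carrier ?S. h i = c \<odot>\<^bsub>?M\<^esub> ?u i"
    using h by (auto simp: cyclic_submodule_def PiE_iff)
  then obtain c where c: "\<And>i. i \<in> I \<Longrightarrow> c i \<in> carrier ?S" "\<And>i. i \<in> I \<Longrightarrow> h i = c i \<odot>\<^bsub>?M\<^esub> ?u i"
    by metis
  have u: "?u i \<in> carrier ?M" if "i \<in> I" for i
    using t[OF that] by (simp add: M invariants_reduce_mod)
  have "h \<in> I \<rightarrow> carrier ?M"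
    using smult_inv_module_residue_ring(2)[OF p HK c(1) u] c(2) by auto
  then have "reduce_mod p f = reduce_mod p (\<Sum>i\<in>I. h i)"
    unfolding fh by (rule finsum_inv_module_residue_ring[OF p I])
  also have "\<dots> = reduce_mod p (\<Sum>i\<in>I. c i * t i)"
  proof (rule reduce_mod_sum_cong)
    fix i assume i: "i \<in> I"
    have "h i = reduce_mod p (c i * ?u i)"
      using smult_inv_module_residue_ring(1)[OF p HK c(1)[OF i] u[OF i]] c(2)[OF i] by simp
    moreover have "reduce_mod p (c i * ?u i) = reduce_mod p (c i * t i)"
      unfolding reduce_mod_eq_iff by (rule dvd_mult_reduce_mod_minus)
    ultimately show "const (int p) dvd h i - c i * t i"
      by (simp only: dvd_reduce_mod_minus)
  qed
  finally have "const (int p) dvd f - (\<Sum>i\<in>I. c i * t i)"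
    by (simp add: reduce_mod_eq_iff)
  then show ?thesis using c(1) carrier_inv_ring_residue_ring[OF p, of n K] by blast
qed

section \<open>From generators over \<open>\<rat>\<close> to generators modulo a prime\<close>

lemma coef_to_rat_mpoly: "coef (to_rat_mpoly f) m = of_int (coef f m)"
  by (simp add: to_rat_mpoly_def map.rep_eq when_def)

lemma to_rat_mpoly_eq_iff: "to_rat_mpoly f = to_rat_mpoly g \<longleftrightarrow> f = g"
  by (simp add: poly_mapping_eq_iff fun_eq_iff coef_to_rat_mpoly)

lemma to_rat_mpoly_mult: "to_rat_mpoly (f * g) = to_rat_mpoly f * to_rat_mpoly g"
  by (rule poly_mapping_eqI) (simp add: coef_to_rat_mpoly lookup_mult_splittings)

lemma to_rat_mpoly_sum: "to_rat_mpoly (\<Sum>i\<in>A. f i) = (\<Sum>i\<in>A. to_rat_mpoly (f i))"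
  by (rule poly_mapping_eqI) (simp add: coef_to_rat_mpoly lookup_sum)

lemma to_rat_mpoly_const: "to_rat_mpoly (const c) = const (of_int c)"
  by (rule poly_mapping_eqI) (simp add: coef_to_rat_mpoly lookup_single when_def)

lemma common_denominator:
  fixes Q :: "rat set"
  assumes "finite Q"
  shows "\<exists>N::nat. N > 0 \<and> (\<forall>q\<in>Q. of_nat N * q \<in> \<int>)"
  using assms
proof (induction Q rule: finite_induct)
  case empty
  then show ?case by (intro exI[of _ 1]) simp
next
  case (insert q Q)
  then obtain N :: nat where N: "N > 0" "\<And>q. q \<in> Q \<Longrightarrow> of_nat N * q \<in> \<int>" by blast
  obtain a b where "quotient_of q = (a, b)" by (cases "quotient_of q")
  then have q: "q = of_int a / of_int b" "b > 0"
    using quotient_of_div quotient_of_denom_pos by blast+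
  then have qb: "of_int b * q = of_int a" by simp
  have b: "of_nat (nat b) = (of_int b :: rat)" using q(2) by simp
  have "of_nat (nat b * N) * r \<in> \<int>" if "r \<in> insert q Q" for r
  proof (cases "r = q")
    case True
    have "of_nat N * (of_int b * q) \<in> \<int>" unfolding qb by simp
    then show ?thesis using True by (simp add: b mult.commute mult.left_commute)
  next
    case False
    have "of_nat (nat b * N) * r = of_int b * (of_nat N * r)"
      by (simp add: b)
    moreover have "of_nat N * r \<in> \<int>" using N(2)[of r] False that by auto
    ultimately show ?thesis by (metis Ints_mult Ints_of_int)
  qed
  then show ?case
    using N(1) q(2) by (intro exI[of _ "nat b * N"] conjI ballI) simp_all
qed

lemma common_denominator_mpoly:
  fixes f :: "'i \<Rightarrow> rat mpoly"
  assumes "finite I"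
  shows "\<exists>N::nat. N > 0 \<and> (\<forall>i\<in>I. to_rat_mpoly (Poly_Mapping.map (\<lambda>q. \<lfloor>of_nat N * q\<rfloor>) (f i)) = const (of_nat N) * f i)"
proof -
  define Q where "Q = (\<Union>i\<in>I. coef (f i) ` Poly_Mapping.keys (f i))"
  have "finite Q" unfolding Q_def using assms by simp
  then obtain N :: nat where N: "N > 0" "\<forall>q\<in>Q. of_nat N * q \<in> \<int>"
    by (elim common_denominator[THEN exE] conjE)
  have int: "of_nat N * coef (f i) m \<in> \<int>" if "i \<in> I" for i m
  proof (cases "coef (f i) m = 0")
    case False
    then have "m \<in> Poly_Mapping.keys (f i)" by (rule in_keys_iff[THEN iffD2])
    then have "coef (f i) m \<in> Q" using that unfolding Q_def by blast
    then show ?thesis using N(2) by blast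
  qed simp
  have "to_rat_mpoly (Poly_Mapping.map (\<lambda>q. \<lfloor>of_nat N * q\<rfloor>) (f i)) = const (of_nat N) * f i" if "i \<in> I" for i
  proof (rule poly_mapping_eqI)
    fix m
    show "coef (to_rat_mpoly (Poly_Mapping.map (\<lambda>q. \<lfloor>of_nat N * q\<rfloor>) (f i))) m = coef (const (of_nat N) * f i) m"
      using int[OF that, of m]
      by (auto simp: coef_to_rat_mpoly map.rep_eq when_def coef_const_mult elim!: Ints_cases)
  qed
  with N(1) show ?thesis by blast
qed

context permutations
begin

lemma invariants_divide_const:
  fixes f :: "int mpoly"
  assumes c: "c \<noteq> 0" and f: "const c * f \<in> invariants n H"
  shows "f \<in> invariants n H"
proof -
  have "Poly_Mapping.keys (const c * f) = Poly_Mapping.keys f"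
    using c by (auto simp: in_keys_iff coef_const_mult)
  moreover have "perm_act \<sigma> f = f" if "\<sigma> \<in> H" for \<sigma>
  proof -
    have "const c * perm_act \<sigma> f = perm_act \<sigma> (const c * f)"
      by (simp only: perm_act_mult[OF bij[OF that]] perm_act_const[OF bij[OF that]])
    also have "\<dots> = const c * f" using f that unfolding invariants_def by blast
    finally show ?thesis using c unfolding mult_cancel_left const_eq_0_iff by blast
  qed
  ultimately show ?thesis using f by (simp add: invariants_def)
qed

lemma integral_multiple_in_span:
  fixes t :: "'i \<Rightarrow> int mpoly"
  assumes I: "finite I" and f: "f \<in> invariants n K"
    and gen: "\<And>g. g \<in> invariants n K \<Longrightarrow>
      \<exists>c. (\<forall>i\<in>I. c i \<in> invariants n H) \<and> g = (\<Sum>i\<in>I. c i * to_rat_mpoly (t i))"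
    and K: "permutations K"
  shows "\<exists>N::nat. N > 0 \<and> (\<exists>c. (\<forall>i\<in>I. c i \<in> invariants n H) \<and> const (int N) * f = (\<Sum>i\<in>I. c i * t i))"
proof -
  have "to_rat_mpoly f \<in> invariants n K"
    unfolding to_rat_mpoly_def by (rule permutations.invariants_map[OF K f])
  then obtain c where c: "\<And>i. i \<in> I \<Longrightarrow> c i \<in> invariants n H"
      "to_rat_mpoly f = (\<Sum>i\<in>I. c i * to_rat_mpoly (t i))"
    using gen by blast
  obtain N :: nat where N: "N > 0"
      "\<And>i. i \<in> I \<Longrightarrow> to_rat_mpoly (Poly_Mapping.map (\<lambda>q. \<lfloor>of_nat N * q\<rfloor>) (c i)) = const (of_nat N) * c i"
    using common_denominator_mpoly[OF I, of c] by blast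
  \<comment> \<open>the floor only serves to name the integers that the coefficients of \<open>N c i\<close> are\<close>
  define d where "d = (\<lambda>i. Poly_Mapping.map (\<lambda>q. \<lfloor>of_nat N * q\<rfloor>) (c i))"
  have "to_rat_mpoly (\<Sum>i\<in>I. d i * t i) = (\<Sum>i\<in>I. const (of_nat N) * c i * to_rat_mpoly (t i))"
    unfolding to_rat_mpoly_sum to_rat_mpoly_mult by (rule sum.cong) (simp_all add: N(2) d_def)
  also have "\<dots> = const (of_nat N) * to_rat_mpoly f"
    by (simp add: c(2) sum_distrib_left mult.assoc)
  also have "\<dots> = to_rat_mpoly (const (int N) * f)"
    by (simp add: to_rat_mpoly_mult to_rat_mpoly_const)
  finally have "const (int N) * f = (\<Sum>i\<in>I. d i * t i)"
    unfolding to_rat_mpoly_eq_iff by (rule sym)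
  moreover have "d i \<in> invariants n H" if "i \<in> I" for i
    unfolding d_def by (rule invariants_map[OF c(1)[OF that]])
  ultimately show ?thesis using N(1) by (intro exI[of _ N] exI[of _ d] conjI ballI)
qed

text \<open>
  If the \<open>t i\<close> generate over \<open>\<rat>\<close>, then some \<open>N > 0\<close> satisfies \<open>N f = \<Sum> c i t i\<close> with integral
  \<open>c i\<close>. The least such \<open>N\<close> is prime to \<open>p\<close>: otherwise the right hand side vanishes modulo \<open>p\<close>, by
  independence \<open>p\<close> divides every \<open>c i\<close>, and the relation can be divided by \<open>p\<close>. So \<open>N\<close> can be
  inverted modulo \<open>p\<close>. This replaces the comparison of Hilbert series over \<open>\<rat>\<close> and \<open>\<bbbF>\<^sub>p\<close>.
\<close>

lemma span_mod_prime:
  fixes t :: "'i \<Rightarrow> int mpoly"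
  assumes p: "prime p"
    and mult: "\<exists>N::nat. N > 0 \<and> (\<exists>c. (\<forall>i\<in>I. c i \<in> invariants n H) \<and> const (int N) * f = (\<Sum>i\<in>I. c i * t i))"
    and indep: "\<And>c j. (\<And>i. i \<in> I \<Longrightarrow> c i \<in> invariants n H) \<Longrightarrow>
      const (int p) dvd (\<Sum>i\<in>I. c i * t i) \<Longrightarrow> j \<in> I \<Longrightarrow> const (int p) dvd c j"
  shows "\<exists>c. (\<forall>i\<in>I. c i \<in> invariants n H) \<and> const (int p) dvd f - (\<Sum>i\<in>I. c i * t i)"
proof -
  have p0: "p > 0" "p > 1" using p prime_gt_0_nat prime_gt_1_nat by blast+
  define good where "good N \<longleftrightarrow> N > 0 \<and>
    (\<exists>c. (\<forall>i\<in>I. c i \<in> invariants n H) \<and> const (int N) * f = (\<Sum>i\<in>I. c i * t i))" for N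
  define N where "N = (LEAST N. good N)"
  have "good N" unfolding N_def by (rule LeastI_ex) (use mult in \<open>simp only: good_def\<close>)
  then obtain c where N: "N > 0" and c: "\<And>i. i \<in> I \<Longrightarrow> c i \<in> invariants n H"
      and Nf: "const (int N) * f = (\<Sum>i\<in>I. c i * t i)"
    unfolding good_def by blast
  \<comment> \<open>otherwise the relation can be divided by \<open>p\<close>, against the choice of \<open>N\<close>\<close>
  have "\<not> p dvd N"
  proof
    assume "p dvd N"
    then obtain N' where N': "N = p * N'" by (rule dvdE)
    have NN': "const (int N) = const (int p) * const (int N')"
      by (simp add: N' mult_single)
    have "const (int p) dvd (\<Sum>i\<in>I. c i * t i)"
      unfolding Nf[symmetric] NN' mult.assoc by (rule dvd_triv_left)
    then have "const (int p) dvd c i" if "i \<in> I" for i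
      using indep[of c i] c that by blast
    then have "\<forall>i\<in>I. \<exists>d. c i = const (int p) * d" by (simp only: dvd_def Ball_def) blast
    then obtain d where d: "\<And>i. i \<in> I \<Longrightarrow> c i = const (int p) * d i" by metis
    have "d i \<in> invariants n H" if "i \<in> I" for i
      using invariants_divide_const[of "int p" "d i"] c[OF that] d[OF that] p0 by simp
    moreover have "const (int N') * f = (\<Sum>i\<in>I. d i * t i)"
    proof -
      have "const (int p) * (const (int N') * f) = const (int p) * (\<Sum>i\<in>I. d i * t i)"
        using Nf unfolding NN' by (simp add: sum_distrib_left mult.assoc d cong: sum.cong)
      moreover have "const (int p) \<noteq> 0" using p0 by (simp add: const_eq_0_iff)
      ultimately show ?thesis unfolding mult_cancel_left by blast
    qed
    moreover have "N' > 0" using N N' by simp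
    ultimately have "good N'" unfolding good_def by blast
    then have "N \<le> N'" unfolding N_def by (rule Least_le)
    then show False using N' \<open>N' > 0\<close> p0 by simp
  qed
  then have "coprime (int N) (int p)"
    using p prime_imp_coprime_nat[of p N] by (simp add: coprime_commute)
  then obtain u where "[int N * u = 1] (mod int p)"
    using cong_solve_coprime_int by blast
  then have u: "int p dvd 1 - u * int N"
    by (simp add: cong_iff_dvd_diff mult.commute dvd_diff_commute)
  have "f - (\<Sum>i\<in>I. const u * c i * t i) = f - const u * (const (int N) * f)"
    by (simp add: Nf sum_distrib_left mult.assoc)
  also have "\<dots> = (const 1 - const (u * int N)) * f"
    by (simp add: left_diff_distrib mult_single flip: mult.assoc)
  also have "\<dots> = const (1 - u * int N) * f"
    by (simp only: single_diff)
  also have "const (int p) dvd \<dots>"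
    using u by (auto simp: const_dvd_iff coef_const_mult)
  finally have "const (int p) dvd f - (\<Sum>i\<in>I. const u * c i * t i)" .
  moreover have "const u * c i \<in> invariants n H" if "i \<in> I" for i
    by (rule invariants_mult[OF invariants_const c[OF that]])
  ultimately show ?thesis by (intro exI[of _ "\<lambda>i. const u * c i"]) simp
qed

end

section \<open>The determinant of a family of invariants\<close>

lemma bij_subgroup_sym_group:
  assumes "subgroup H (sym_group n)" "\<sigma> \<in> H"
  shows "\<sigma> permutes {1..n}" "bij \<sigma>"
  using subgroup.mem_carrier[OF assms] by (auto simp: sym_group_carrier permutes_bij)

lemma permutations_subgroup: "subgroup H (sym_group n) \<Longrightarrow> permutations H"
  by (rule permutations.intro) (rule bij_subgroup_sym_group)

text \<open>
  The monomial \<open>x\<^sub>1 x\<^sub>2\<^sup>2 \<cdots> x\<^sub>n\<^sup>n\<close>: its exponents are distinct and non-zero, so that no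
  permutation other than the identity fixes it.
\<close>

definition distinct_monomial :: "nat \<Rightarrow> nat \<Rightarrow>\<^sub>0 nat" where
  "distinct_monomial n = (\<Sum>i = 1..n. Poly_Mapping.single i i)"

lemma lookup_distinct_monomial:
  "Poly_Mapping.lookup (distinct_monomial n) i = (if i \<in> {1..n} then i else 0)"
  by (simp add: distinct_monomial_def lookup_sum lookup_single when_def)

lemma keys_distinct_monomial: "Poly_Mapping.keys (distinct_monomial n) = {1..n}"
  by (auto simp: in_keys_iff lookup_distinct_monomial split: if_splits)

lemma lookup_map_key_permutes:
  "\<sigma> permutes {1..n} \<Longrightarrow> Poly_Mapping.lookup (Poly_Mapping.map_key \<sigma> m) i = Poly_Mapping.lookup m (\<sigma> i)"
  by (simp add: map_key.rep_eq permutes_inj)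

lemma map_key_distinct_monomial_inj:
  assumes \<sigma>: "\<sigma> permutes {1..n}" and \<tau>: "\<tau> permutes {1..n}"
    and eq: "Poly_Mapping.map_key \<sigma> (distinct_monomial n) = Poly_Mapping.map_key \<tau> (distinct_monomial n)"
  shows "\<sigma> = \<tau>"
proof
  fix i
  show "\<sigma> i = \<tau> i"
  proof (cases "i \<in> {1..n}")
    case True
    then show ?thesis
      using arg_cong[OF eq, of "\<lambda>m. Poly_Mapping.lookup m i"] permutes_in_image[OF \<sigma>, of i]
        permutes_in_image[OF \<tau>, of i]
      by (simp add: lookup_map_key_permutes[OF \<sigma>] lookup_map_key_permutes[OF \<tau>] lookup_distinct_monomial)
  next
    case False
    then show ?thesis using \<sigma> \<tau> by (simp add: permutes_not_in)
  qed
qed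

text \<open>
  Which monomial of a regular orbit is the largest depends on the monomial order; it suffices to
  choose the maximum.
\<close>

lemma exists_top_monomial:
  fixes n :: nat
  obtains a :: "nat \<Rightarrow>\<^sub>0 nat" where "Poly_Mapping.keys a = {1..n}"
    and "\<And>\<sigma>. \<sigma> permutes {1..n} \<Longrightarrow> \<sigma> \<noteq> id \<Longrightarrow> Poly_Mapping.map_key \<sigma> a < a"
proof -
  let ?O = "(\<lambda>\<sigma>. Poly_Mapping.map_key \<sigma> (distinct_monomial n)) ` {\<sigma>. \<sigma> permutes {1..n}}"
  have fin: "finite ?O" by (simp add: finite_permutations)
  have "?O \<noteq> {}" using permutes_id by blast
  then have "Max ?O \<in> ?O" by (rule Max_in[OF fin])
  then obtain \<tau> where \<tau>: "\<tau> permutes {1..n}" "Max ?O = Poly_Mapping.map_key \<tau> (distinct_monomial n)"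
    by blast
  have "Poly_Mapping.keys (Max ?O) = {1..n}"
    unfolding \<tau>(2) keys_map_key[OF permutes_inj[OF \<tau>(1)]] keys_distinct_monomial
    using \<tau>(1) by (rule permutes_vimage)
  moreover have "Poly_Mapping.map_key \<sigma> (Max ?O) < Max ?O" if \<sigma>: "\<sigma> permutes {1..n}" "\<sigma> \<noteq> id" for \<sigma>
  proof -
    have comp: "Poly_Mapping.map_key \<sigma> (Max ?O) = Poly_Mapping.map_key (\<tau> \<circ> \<sigma>) (distinct_monomial n)"
      unfolding \<tau>(2) by (rule map_key_compose) (auto intro: permutes_inj \<sigma> \<tau>)
    have perm: "\<tau> \<circ> \<sigma> permutes {1..n}" by (rule permutes_compose[OF \<sigma>(1) \<tau>(1)])
    then have "Poly_Mapping.map_key \<sigma> (Max ?O) \<le> Max ?O"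
      unfolding comp by (intro Max_ge[OF fin]) blast
    moreover have "Poly_Mapping.map_key \<sigma> (Max ?O) \<noteq> Max ?O"
    proof
      assume "Poly_Mapping.map_key \<sigma> (Max ?O) = Max ?O"
      then have "Poly_Mapping.map_key (\<tau> \<circ> \<sigma>) (distinct_monomial n) = Poly_Mapping.map_key \<tau> (distinct_monomial n)"
        unfolding comp[symmetric] \<tau>(2)[symmetric] .
      then have "\<tau> \<circ> \<sigma> = \<tau>" by (rule map_key_distinct_monomial_inj[OF perm \<tau>(1)])
      then have "\<sigma> = id" using permutes_inj[OF \<tau>(1)] by (metis (no_types) comp_apply ext id_apply injD)
      with \<sigma>(2) show False ..
    qed
    ultimately show ?thesis by (rule order_neq_le_trans[rotated])
  qed
  ultimately show thesis by (rule that)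
qed

text \<open>
  A family of invariants whose determinant is non-zero modulo every prime. Let \<open>a\<close> be strictly
  above its other conjugates, and let \<open>f\<^sub>j\<close> be the sum of the monomials \<open>g \<gamma>\<^sub>j\<inverse> a\<close> for \<open>g \<in> G\<close>.
  The monomials of \<open>\<gamma>\<^sub>i f\<^sub>j\<close> are the \<open>\<gamma>\<^sub>i g \<gamma>\<^sub>j\<inverse> a\<close>, and one of them is \<open>a\<close> only if
  \<open>\<gamma>\<^sub>i g = \<gamma>\<^sub>j\<close>, that is, if \<open>i = j\<close> and \<open>g = 1\<close>. So the coefficients at \<open>a\<close> form the
  identity matrix.
\<close>

lemma det_orbit_sums:
  fixes n l :: nat
  assumes G: "subgroup G (sym_group n)"
    and \<gamma>: "\<And>i. i < l \<Longrightarrow> \<gamma> i permutes {1..n}"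
    and cosets: "\<And>i j g. i < l \<Longrightarrow> j < l \<Longrightarrow> g \<in> G \<Longrightarrow> \<gamma> i \<circ> g = \<gamma> j \<Longrightarrow> i = j"
  obtains f :: "nat \<Rightarrow> int mpoly" and a where "\<forall>j<l. f j \<in> invariants n G"
    and "coef (det (secondary_matrix l \<gamma> f)) a = 1"
proof -
  obtain a :: "nat \<Rightarrow>\<^sub>0 nat" where keys: "Poly_Mapping.keys a = {1..n}"
    and top: "\<And>\<sigma>. \<sigma> permutes {1..n} \<Longrightarrow> \<sigma> \<noteq> id \<Longrightarrow> Poly_Mapping.map_key \<sigma> a < a"
    using exists_top_monomial[of n] by blast
  note perm = bij_subgroup_sym_group(1)[OF G]
  have fin: "finite G"
    using finite_subset[OF subgroup.subset[OF G]] by (simp add: sym_group_def finite_permutations)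
  have comp: "g \<circ> h \<in> G" if "g \<in> G" "h \<in> G" for g h
    using subgroup.m_closed[OF G that] by (simp add: sym_group_mult)
  have inv: "inv' g \<in> G" if "g \<in> G" for g
    using subgroup.m_inv_closed[OF G that] subgroup.mem_carrier[OF G that]
    by (simp add: sym_group_inv_equality)
  have id: "id \<in> G" using subgroup.one_closed[OF G] by (simp add: sym_group_one)
  \<comment> \<open>\<open>x \<sigma>\<close> is the monomial \<open>\<sigma> a\<close>\<close>
  define x where "x \<sigma> = (Poly_Mapping.single (Poly_Mapping.map_key (inv' \<sigma>) a) 1 :: int mpoly)" for \<sigma>
  have act: "perm_act \<sigma> (x \<tau>) = x (\<sigma> \<circ> \<tau>)" if "\<sigma> permutes {1..n}" "\<tau> permutes {1..n}" for \<sigma> \<tau>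
  proof -
    have "inv' (\<sigma> \<circ> \<tau>) = inv' \<tau> \<circ> inv' \<sigma>"
      using that by (intro o_inv_distrib permutes_bij)
    moreover have "inj (inv' \<sigma>)" "inj (inv' \<tau>)"
      using that by (auto intro: permutes_inj permutes_inv)
    ultimately show ?thesis
      using that by (simp add: x_def perm_act_single permutes_bij map_key_compose)
  qed
  have coef_x: "coef (x \<sigma>) y = (if \<sigma> = id then if y = a then 1 else 0 else 0)"
    if "\<sigma> permutes {1..n}" "a \<le> y" for \<sigma> y
  proof (cases "\<sigma> = id")
    case True
    then show ?thesis by (simp add: x_def lookup_single when_def map_key_id[unfolded id_def[symmetric]])
  next
    case False
    then have "inv' \<sigma> \<noteq> id" using that(1) by (metis inv_id permutes_inv_inv)
    then have "Poly_Mapping.map_key (inv' \<sigma>) a < a"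
      using top[OF permutes_inv[OF that(1)]] by blast
    then show ?thesis using False that(2) by (simp add: x_def lookup_single when_def)
  qed
  define f where "f j = (\<Sum>g\<in>G. x (g \<circ> inv' (\<gamma> j)))" for j
  have f: "f j \<in> invariants n G" if j: "j < l" for j
  proof -
    have "perm_act h (f j) = f j" if h: "h \<in> G" for h
    proof -
      have "perm_act h (f j) = (\<Sum>g\<in>G. x (h \<circ> (g \<circ> inv' (\<gamma> j))))"
        unfolding f_def perm_act_sum[OF permutes_bij[OF perm[OF h]]]
        by (intro sum.cong refl act perm h permutes_compose permutes_inv \<gamma> j)
      also have "\<dots> = f j"
        unfolding f_def
        by (rule sum.reindex_bij_witness[of _ "\<lambda>g. inv' h \<circ> g" "\<lambda>g. h \<circ> g"])
          (auto simp: comp inv h o_assoc permutes_inv_o[OF perm[OF h]])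
      finally show ?thesis .
    qed
    moreover have "Poly_Mapping.keys m \<subseteq> {1..n}" if "m \<in> Poly_Mapping.keys (f j)" for m
    proof -
      obtain g where g: "g \<in> G" "m \<in> Poly_Mapping.keys (x (g \<circ> inv' (\<gamma> j)))"
        using \<open>m \<in> Poly_Mapping.keys (f j)\<close> keys_sum[of "\<lambda>g. x (g \<circ> inv' (\<gamma> j))" G] unfolding f_def by blast
      define \<sigma> where "\<sigma> = inv' (g \<circ> inv' (\<gamma> j))"
      have \<sigma>: "\<sigma> permutes {1..n}"
        unfolding \<sigma>_def by (intro permutes_inv permutes_compose \<gamma> j perm g)
      have "m = Poly_Mapping.map_key \<sigma> a" using g(2) by (simp add: x_def \<sigma>_def)
      then show ?thesis
        using permutes_vimage[OF \<sigma>] by (simp add: keys_map_key[OF permutes_inj[OF \<sigma>]] keys)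
    qed
    ultimately show ?thesis unfolding invariants_def by blast
  qed
  have coef_M: "coef (perm_act (\<gamma> i) (f j)) y = (if i = j \<and> y = a then 1 else 0)"
    if ij: "i < l" "j < l" and y: "a \<le> y" for i j y
  proof -
    have pg: "\<gamma> i \<circ> (g \<circ> inv' (\<gamma> j)) permutes {1..n}" if "g \<in> G" for g
      by (intro permutes_compose permutes_inv \<gamma> ij perm that)
    have "coef (perm_act (\<gamma> i) (f j)) y = (\<Sum>g\<in>G. coef (x (\<gamma> i \<circ> (g \<circ> inv' (\<gamma> j)))) y)"
      unfolding f_def perm_act_sum[OF permutes_bij[OF \<gamma>[OF ij(1)]]] lookup_sum
      by (intro sum.cong refl arg_cong2[of _ _ _ _ coef] act permutes_compose permutes_inv \<gamma> ij perm)
    also have "\<dots> = (\<Sum>g\<in>G. if g = id then (if i = j \<and> y = a then 1 else 0) else 0)"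
    proof (rule sum.cong[OF refl])
      fix g assume g: "g \<in> G"
      have "\<gamma> i \<circ> (g \<circ> inv' (\<gamma> j)) = id \<longleftrightarrow> \<gamma> i \<circ> g = \<gamma> j"
        using permutes_inv_o[OF \<gamma>[OF ij(2)]] by (metis comp_assoc comp_id id_comp)
      also have "\<dots> \<longleftrightarrow> g = id \<and> i = j"
      proof
        assume *: "\<gamma> i \<circ> g = \<gamma> j"
        then have "i = j" by (rule cosets[OF ij g])
        moreover have "g = id"
          using * \<open>i = j\<close> permutes_inv_o(2)[OF \<gamma>[OF ij(2)]] by (metis comp_assoc id_comp)
        ultimately show "g = id \<and> i = j" by simp
      qed simp
      finally show "coef (x (\<gamma> i \<circ> (g \<circ> inv' (\<gamma> j)))) y = (if g = id then (if i = j \<and> y = a then 1 else 0) else 0)"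
        unfolding coef_x[OF pg[OF g] y] by auto
    qed
    also have "\<dots> = (if i = j \<and> y = a then 1 else 0)"
      using fin id by (simp only: sum.delta if_True)
    finally show ?thesis .
  qed
  have "coef (det (secondary_matrix l \<gamma> f)) (\<Sum>i = 0..<l. a) =
      det (mat l l (\<lambda>(i, j). coef (secondary_matrix l \<gamma> f $$ (i, j)) a))"
    by (rule coef_det) (auto simp: secondary_matrix_def coef_M)
  also have "mat l l (\<lambda>(i, j). coef (secondary_matrix l \<gamma> f $$ (i, j)) a) = 1\<^sub>m l"
    by (rule eq_matI) (auto simp: secondary_matrix_def coef_M)
  finally have "coef (det (secondary_matrix l \<gamma> f)) (\<Sum>i = 0..<l. a) = 1" by simp
  moreover have "\<forall>j<l. f j \<in> invariants n G" using f by simp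
  ultimately show thesis by (rule that[rotated])
qed

section \<open>The determinant criterion\<close>

lemma secondary_matrix_carrier: "secondary_matrix l \<gamma> t \<in> carrier_mat l l"
  by (simp add: secondary_matrix_def)

text \<open>
  The \<open>c j\<close> are fixed by every \<open>\<gamma> i\<close>, so applying \<open>\<gamma> i\<close> to a relation among the \<open>t j\<close> gives the
  \<open>i\<close>-th line of a linear system with matrix \<open>M(t)\<close> for the same \<open>c\<close>.
\<close>

lemma independent_if_not_dvd_det:
  assumes p: "prime p"
    and \<gamma>: "\<And>i. i < l \<Longrightarrow> bij (\<gamma> i)" "\<And>i. i < l \<Longrightarrow> \<gamma> i \<in> K"
    and det: "\<not> const (int p) dvd det (secondary_matrix l \<gamma> t)"
    and c: "\<And>i. i < l \<Longrightarrow> c i \<in> invariants n K"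
    and dvd: "const (int p) dvd (\<Sum>i<l. c i * t i)" and j: "j < l"
  shows "const (int p) dvd c j"
proof -
  have "const (int p) dvd (\<Sum>j<l. secondary_matrix l \<gamma> t $$ (i, j) * c j)" if i: "i < l" for i
  proof -
    have "const (int p) dvd perm_act (\<gamma> i) (\<Sum>j<l. c j * t j)"
      by (rule perm_act_dvd[OF \<gamma>(1)[OF i] dvd])
    also have "perm_act (\<gamma> i) (\<Sum>j<l. c j * t j) = (\<Sum>j<l. secondary_matrix l \<gamma> t $$ (i, j) * c j)"
    proof -
      have "perm_act (\<gamma> i) (c j) = c j" if "j < l" for j
        using c[OF that] \<gamma>(2)[OF i] unfolding invariants_def by blast
      then show ?thesis
        using i by (simp add: perm_act_sum \<gamma>(1) perm_act_mult secondary_matrix_def mult.commute)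
    qed
    finally show ?thesis .
  qed
  then have "const (int p) dvd det (secondary_matrix l \<gamma> t) * c j"
    by (rule det_mult_dvd[OF secondary_matrix_carrier _ j])
  moreover have "prime_elem (const (int p))" using p by (intro prime_elem_const) simp
  ultimately show ?thesis using det unfolding prime_elem_def by blast
qed

text \<open>
  Writing each \<open>f j\<close> as a combination of the \<open>t i\<close> modulo \<open>b\<close> gives \<open>M(f) \<equiv> M(t) C\<close>, because the
  coefficients \<open>C\<close> are fixed by every \<open>\<gamma> i\<close>. So \<open>det M(t)\<close> divides \<open>det M(f)\<close> modulo \<open>b\<close>.
\<close>

lemma not_dvd_det_if_span:
  assumes \<gamma>: "\<And>i. i < l \<Longrightarrow> bij (\<gamma> i)" "\<And>i. i < l \<Longrightarrow> \<gamma> i \<in> K"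
    and span: "\<And>j. j < l \<Longrightarrow>
      \<exists>c. (\<forall>i\<in>{..<l}. c i \<in> invariants n K) \<and> const b dvd f j - (\<Sum>i<l. c i * t i)"
    and det: "\<not> const b dvd det (secondary_matrix l \<gamma> f)"
  shows "\<not> const b dvd det (secondary_matrix l \<gamma> t)"
proof
  assume t: "const b dvd det (secondary_matrix l \<gamma> t)"
  have "\<forall>j\<in>{..<l}. \<exists>c. (\<forall>i\<in>{..<l}. c i \<in> invariants n K) \<and> const b dvd f j - (\<Sum>i<l. c i * t i)"
    using span by simp
  from bchoice[OF this] obtain c where c: "\<And>i j. i < l \<Longrightarrow> j < l \<Longrightarrow> c j i \<in> invariants n K"
      "\<And>j. j < l \<Longrightarrow> const b dvd f j - (\<Sum>i<l. c j i * t i)"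
    by auto
  define C where "C = mat l l (\<lambda>(i, j). c j i)"
  have C: "C \<in> carrier_mat l l" by (simp add: C_def)
  let ?M = "secondary_matrix l \<gamma>"
  note M = secondary_matrix_carrier
  have "const b dvd ?M f $$ (i, j) - (?M t * C) $$ (i, j)" if i: "i < l" and j: "j < l" for i j
  proof -
    have "perm_act (\<gamma> i) (c j r) = c j r" if "r < l" for r
      using c(1)[OF that j] \<gamma>(2)[OF i] unfolding invariants_def by blast
    then have "(?M t * C) $$ (i, j) = perm_act (\<gamma> i) (\<Sum>r<l. c j r * t r)"
      using i j by (simp add: secondary_matrix_def C_def scalar_prod_def atLeast0LessThan perm_act_sum
          \<gamma>(1) perm_act_mult mult.commute)
    moreover have "?M f $$ (i, j) = perm_act (\<gamma> i) (f j)"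
      using i j by (simp add: secondary_matrix_def)
    moreover obtain h where "f j - (\<Sum>r<l. c j r * t r) = const b * h"
      using c(2)[OF j] by (rule dvdE)
    then have "f j = const b * h + (\<Sum>r<l. c j r * t r)" by (simp add: algebra_simps)
    ultimately have "?M f $$ (i, j) - (?M t * C) $$ (i, j) = const b * perm_act (\<gamma> i) h"
      by (simp add: perm_act_add \<gamma>(1)[OF i] perm_act_mult perm_act_const)
    then show ?thesis by simp
  qed
  then have "const b dvd det (?M f) - det (?M t * C)"
    by (intro det_diff_dvd[OF M mult_carrier_mat[OF M C]])
  moreover have "const b dvd det (?M t * C)"
    unfolding det_mult[OF M C] using t by (rule dvd_mult2)
  ultimately have "const b dvd det (?M f) - det (?M t * C) + det (?M t * C)"
    by (rule dvd_add)
  then have "const b dvd det (?M f)" by simp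
  with det show False ..
qed

lemma dvd_mpoly_content_iff: "b dvd mpoly_content f \<longleftrightarrow> const b dvd f"
  by (auto simp: mpoly_content_def dvd_Gcd_iff const_dvd_iff)

theorem corollary5p2:
  fixes k :: "nat list" and p :: nat
    and G :: "(nat \<Rightarrow> nat) set"
    and \<gamma> :: "nat \<Rightarrow> nat \<Rightarrow> nat"
    and \<theta> :: "nat \<Rightarrow> int mpoly"
  assumes "subgroup G (young_group k)"
    and "left_coset_reps k G \<gamma>"
    and "universal_secondaries k G \<theta>"
    and "prime p"
  shows "cohen_macaulay (residue_ring (int p)) k G \<longleftrightarrow> \<not> int p dvd mho k G \<gamma> \<theta>"
proof -
  define n where "n = sum_list k"
  define K where "K = young_subgroup k"
  define l where "l = young_index k G"
  define Y where "Y = young_group k"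
  let ?S = "inv_ring (residue_ring (int p)) n K"
  let ?M = "inv_module (residue_ring (int p)) n G"
  let ?P = "const (int p)"
  have p: "p > 1" by (rule prime_gt_1_nat[OF \<open>prime p\<close>])
  have K: "subgroup K (sym_group n)"
    unfolding K_def n_def by (rule subgroup_young_subgroup)
  have Y_def': "Y = (sym_group n)\<lparr>carrier := K\<rparr>"
    by (simp add: Y_def young_group_def n_def K_def)
  have Y: "group Y" unfolding Y_def' by (rule subgroup.subgroup_is_group[OF K sym_group_is_group])
  have GY: "subgroup G Y" using assms(1) by (simp add: Y_def)
  have GK: "G \<subseteq> K" using subgroup.subset[OF GY] by (simp add: Y_def')
  have G: "subgroup G (sym_group n)"
    using group.incl_subgroup[OF sym_group_is_group K] GY by (simp add: Y_def')
  interpret G: permutations G by (rule permutations_subgroup[OF G])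
  interpret K: permutations K by (rule permutations_subgroup[OF K])
  have \<gamma>K: "\<gamma> i \<in> K" if "i < l" for i
    using assms(2) that by (simp add: left_coset_reps_def l_def Y_def'[unfolded Y_def])
  have inj: "inj_on (\<lambda>i. \<gamma> i <#\<^bsub>Y\<^esub> G) {..<l}"
    using assms(2) by (simp add: left_coset_reps_def l_def Y_def bij_betw_def)
  have cosets: "i = j" if "i < l" "j < l" "g \<in> G" "\<gamma> i \<circ> g = \<gamma> j" for i j g
  proof -
    have "\<gamma> j \<in> \<gamma> i <#\<^bsub>Y\<^esub> G"
      using that(3,4) by (auto simp: l_coset_def Y_def' sym_group_mult intro!: bexI[of _ g])
    then have "\<gamma> i <#\<^bsub>Y\<^esub> G = \<gamma> j <#\<^bsub>Y\<^esub> G"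
      by (rule group.l_repr_independence[OF Y _ _ GY]) (simp add: Y_def' \<gamma>K that)
    then show ?thesis using inj that by (auto dest: inj_onD)
  qed
  have \<theta>: "\<theta> i \<in> invariants n G" if "i < l" for i
    using assms(3) that by (simp add: universal_secondaries_def carrier_inv_ring_class_ring n_def l_def)
  have mho: "int p dvd mho k G \<gamma> \<theta> \<longleftrightarrow> ?P dvd det (secondary_matrix l \<gamma> \<theta>)"
    by (simp add: mho_def dvd_mpoly_content_iff l_def)
  show ?thesis
  proof
    assume "cohen_macaulay (residue_ring (int p)) k G"
    then have sum: "internal_direct_sum ?M {..<l} (\<lambda>i. cyclic_submodule ?S ?M (reduce_mod p (\<theta> i)))"
      using assms(3,4) by (simp add: universal_secondaries_def Let_def n_def K_def l_def)
    obtain f a where f: "\<forall>j<l. f j \<in> invariants n G"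
        and a: "coef (det (secondary_matrix l \<gamma> f)) a = 1"
    proof (rule det_orbit_sums[OF G, of l \<gamma>])
      show "\<gamma> i permutes {1..n}" if "i < l" for i
        by (rule bij_subgroup_sym_group(1)[OF K \<gamma>K[OF that]])
      show "i = j" if "i < l" "j < l" "g \<in> G" "\<gamma> i \<circ> g = \<gamma> j" for i j g
        by (rule cosets[OF that])
    qed (rule that)
    have det: "\<not> ?P dvd det (secondary_matrix l \<gamma> f)"
    proof
      assume "?P dvd det (secondary_matrix l \<gamma> f)"
      then have "int p dvd coef (det (secondary_matrix l \<gamma> f)) a"
        by (rule const_dvd_iff[THEN iffD1, rule_format])
      then show False using p a by simp
    qed
    show "\<not> int p dvd mho k G \<gamma> \<theta>"
      unfolding mho
    proof (rule not_dvd_det_if_span[OF _ _ _ det])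
      show "bij (\<gamma> i)" "\<gamma> i \<in> K" if "i < l" for i
        using \<gamma>K[OF that] by (auto intro: K.bij)
      show "\<exists>c. (\<forall>i\<in>{..<l}. c i \<in> invariants n K) \<and> ?P dvd f j - (\<Sum>i<l. c i * \<theta> i)"
        if "j < l" for j
      proof (rule G.internal_direct_sum_span[OF p GK finite_lessThan _ sum])
        show "\<theta> i \<in> invariants n G" if "i \<in> {..<l}" for i using that by (simp add: \<theta>)
        show "f j \<in> invariants n G" using f that by blast
      qed
    qed
  next
    assume "\<not> int p dvd mho k G \<gamma> \<theta>"
    then have det: "\<not> ?P dvd det (secondary_matrix l \<gamma> \<theta>)" unfolding mho .
    have indep: "?P dvd c j" if "\<And>i. i \<in> {..<l} \<Longrightarrow> c i \<in> invariants n K"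
        "?P dvd (\<Sum>i<l. c i * \<theta> i)" "j \<in> {..<l}" for c j
      by (rule independent_if_not_dvd_det[OF \<open>prime p\<close> K.bij[OF \<gamma>K] \<gamma>K det]) (use that in auto)
    have gen: "\<exists>c. (\<forall>i\<in>{..<l}. c i \<in> invariants n K) \<and> g = (\<Sum>i<l. c i * to_rat_mpoly (\<theta> i))"
      if g: "g \<in> invariants n G" for g
    proof -
      let ?S = "inv_ring class_ring n K :: rat mpoly ring"
      let ?M = "inv_module class_ring n G :: (rat mpoly, rat mpoly) module"
      have gens: "generates ?S ?M {..<l} (\<lambda>i. to_rat_mpoly (\<theta> i))"
        using assms(3) by (simp add: universal_secondaries_def secondaries_def Let_def n_def K_def l_def)
      have "g \<in> carrier ?M" using g by (simp add: inv_module_simps(1) carrier_inv_ring_class_ring)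
      then obtain c where c: "c \<in> {..<l} \<rightarrow> carrier ?S"
          "g = (\<Oplus>\<^bsub>?M\<^esub>i \<in> {..<l}. c i \<odot>\<^bsub>?M\<^esub> to_rat_mpoly (\<theta> i))"
        using gens unfolding generates_def by blast
      have cK: "c i \<in> invariants n K" if "i < l" for i
        using c(1) that by (auto simp: carrier_inv_ring_class_ring)
      have sm: "c i \<odot>\<^bsub>?M\<^esub> to_rat_mpoly (\<theta> i) = c i * to_rat_mpoly (\<theta> i)" for i
        unfolding inv_module_simps(5) by (rule mpoly_ring_class_ring(1))
      have "g = (\<Sum>i<l. c i * to_rat_mpoly (\<theta> i))"
        unfolding c(2) sm
      proof (rule G.finsum_inv_module_class_ring, simp, rule Pi_I)
        fix i assume "i \<in> {..<l}"
        then have "c i \<in> invariants n G" "to_rat_mpoly (\<theta> i) \<in> invariants n G"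
          using cK \<theta> invariants_antimono[OF GK] unfolding to_rat_mpoly_def
          by (auto intro: G.invariants_map)
        then show "c i * to_rat_mpoly (\<theta> i) \<in> invariants n G" by (rule G.invariants_mult)
      qed
      with cK show ?thesis by auto
    qed
    have span: "\<exists>c. (\<forall>i\<in>{..<l}. c i \<in> invariants n K) \<and> ?P dvd f - (\<Sum>i<l. c i * \<theta> i)"
      if f: "f \<in> invariants n G" for f
    proof (rule K.span_mod_prime[OF \<open>prime p\<close>])
      show "\<exists>N::nat. N > 0 \<and> (\<exists>c. (\<forall>i\<in>{..<l}. c i \<in> invariants n K) \<and>
          const (int N) * f = (\<Sum>i<l. c i * \<theta> i))"
        by (rule K.integral_multiple_in_span[OF finite_lessThan f _ G.permutations_axioms]) (rule gen)
    qed (rule indep)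
    have "module_basis ?S ?M ((\<lambda>i. reduce_mod p (\<theta> i)) ` {..<l})"
    proof (rule G.module_basis_reduce_mod[OF p GK])
      show "bij \<sigma>" if "\<sigma> \<in> K" for \<sigma> by (rule K.bij[OF that])
      show "\<theta> i \<in> invariants n G" if "i \<in> {..<l}" for i using that by (simp add: \<theta>)
      show "\<exists>c. (\<forall>i\<in>{..<l}. c i \<in> invariants n K) \<and> ?P dvd f - (\<Sum>i<l. c i * \<theta> i)"
        if "f \<in> invariants n G" for f by (rule span[OF that])
      show "?P dvd c j" if "\<And>i. i \<in> {..<l} \<Longrightarrow> c i \<in> invariants n K"
        "?P dvd (\<Sum>i<l. c i * \<theta> i)" "j \<in> {..<l}" for c j by (rule indep[OF that])
    qed simp
    then show "cohen_macaulay (residue_ring (int p)) k G"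
      unfolding cohen_macaulay_def free_module_def n_def K_def by blast
  qed
qed

end
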